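(* Let $(\mathcal M,X)$ be an irreducible concurrent system equipped with a valuation $f=(f_\alpha)_{\alpha\in X}$. Let $\rho>0$ and $\Delta:X\times X\to\mathbb R_{>0}$ be the unique positive real and the unique positive cocycle such that the valuation $\widetilde f_\alpha(x)=\rho^{|x|}\Delta(\alpha,\alpha\cdot x)f_\alpha(x)$ is probabilistic. Let $\mathsf M(t)$ be the Möbius matrix and $\theta(t)=\det\mathsf M(t)$. Then: 1. $\rho$ is the positive root of $\theta(t)$ of smallest modulus among its complex roots; that is, $\theta(\rho)=0$ and every complex root $z$ of $\theta$ satisfies $|z|\geqslant\rho$. 2. $\dim(\ker\mathsf M(\rho))=1$, and $\ker\mathsf M(\rho)$ is generated by a vector $U=(U_\alpha)_{\alpha\in X}$ with positive entries. Furthermore, $\Delta(\alpha,\beta)=U_\beta/U_\alpha$ for all $\alpha,\beta\in X$.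
   Context: Trace monoids. Let $\Sigma$ be a finite set and $I\subseteq\Sigma\times\Sigma$ irreflexive and symmetric. The trace monoid $\mathcal M=\mathcal M(\Sigma,I)$ is presented by $\langle\Sigma\mid ab=ba\text{ for }(a,b)\in I\rangle$. Its elements are traces, $\varepsilon$ is the unit, $|x|$ is the length of $x$, and $x\leqslant y$ means $y=xz$ for some $z\in\mathcal M$. $\mathcal M$ is irreducible if the graph $(\Sigma,(\Sigma\times\Sigma)\setminus I)$ is connected. A clique is a trace $a_1\cdots a_k$ of letters with $(a_i,a_j)\in I$ for $i\neq j$ (the empty trace included); $\mathcal C$ is the set of cliques, identified with subsets of $\Sigma$. For cliques write $c\to d$ if for every letter $b\in d$ there is a letter $a\in c$ with $(a,b)\notin I$. Infinite traces. An infinite trace is a sequence $\omega=(c_i)_{i\geqslant1}$ of non-empty cliques with $c_i\to c_{i+1}$ for all $i$; write $C_i(\omega)=c_i$. The set $\partial\mathcal M$ of infinite traces carries its Borel $\sigma$-algebra. For $x\in\mathcal M$, $x\leqslant\omega$ means $x\leqslant C_1(\omega)\cdots C_n(\omega)$ for some $n$, and ${\uparrow}x=\{\omega\in\partial\mathcal M:x\leqslant\omega\}$. Concurrent systems. A concurrent system is a pair $(\mathcal M,X)$, $X$ a finite set of states, with a right monoid action of $\mathcal M$ on $X\sqcup\{\bot\}$, where $\bot\cdot x=\bot$ for all $x$. Put $\mathcal M_\alpha=\{x:\alpha\cdot x\neq\bot\}$, $\mathcal M_{\alpha,\beta}=\{x:\alpha\cdot x=\beta\}$, $\mathcal C_{\alpha,\beta}=\mathcal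 C\cap\mathcal M_{\alpha,\beta}$, and $\partial\mathcal M_\alpha=\{\omega\in\partial\mathcal M: x\in\mathcal M_\alpha\text{ for all }x\in\mathcal M\text{ with }x\leqslant\omega\}$. Non-trivial: $\alpha\cdot a\neq\bot$ for some $\alpha\in X$, $a\in\Sigma$. Transitive: $\mathcal M_{\alpha,\beta}\neq\emptyset$ for all $\alpha,\beta\in X$. Irreducible: (1) transitive and non-trivial; (2) $\mathcal M$ is irreducible; (3) for all $\alpha\in X$, $a\in\Sigma$ there is $u\in\mathcal M$ with $\alpha\cdot(ua)\neq\bot$. Valuations and Markov measures. A valuation is a family $f=(f_\alpha)_{\alpha\in X}$ of functions $f_\alpha:\mathcal M\to\mathbb R_{\geqslant0}$ with $f_\alpha(x)>0\iff\alpha\cdot x\neq\bot$ and $f_\alpha(xy)=f_\alpha(x)f_{\alpha\cdot x}(y)$ (right-hand side $0$ if $\alpha\cdot x=\bot$). A Markov measure is a family $m=(m_\alpha)_{\alpha\in X}$ of probability measures on $\partial\mathcal M$ with $m_\alpha(\partial\mathcal M_\alpha)=1$, $x\in\mathcal M_\alpha\iff m_\alpha({\uparrow}x)>0$, and $m_\alpha({\uparrow}(xy))=m_\alpha({\uparrow}x)\,m_{\alpha\cdot x}({\uparrow}y)$. A valuation $f$ is probabilistic if $f_\alpha(x)=m_\alpha({\uparrow}x)$ for all $(\alpha,x)\in X\times\mathcal M$, for some Markov measure $m$. Cocycles. A positive cocycle is $\Delta:X\times X\to\mathbb R_{>0}$ with $\Delta(\alpha,\gamma)=\Delta(\alpha,\beta)\Delta(\beta,\gamma)$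 for all $\alpha,\beta,\gamma$. For an irreducible system with a valuation $f$, there is a unique pair $(\rho,\Delta)$ as in the claim; moreover $\rho$ is the common radius of convergence of the series $\sum_{x\in\mathcal M_\alpha}f_\alpha(x)s^{|x|}$, $\alpha\in X$. Möbius matrix. $\mathsf M(t)$ is the $X\times X$ matrix of polynomials $\mathsf M_{\alpha,\beta}(t)=\sum_{c\in\mathcal C_{\alpha,\beta}}(-1)^{|c|}f_\alpha(c)\,t^{|c|}$. *)

theory Defs
  imports
    "HOL-Algebra.Group"
    "HOL-Probability.Probability"
    "HOL-Computational_Algebra.Polynomial"
begin

text \<open>The alphabet is the finite type \<open>'a\<close>. A trace is a congruence class of words for the
  least monoid congruence identifying \<open>ab\<close> and \<open>ba\<close> whenever \<open>(a, b) \<in> I\<close>.\<close>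

type_synonym 'a trace = "'a list set"

inductive_set trace_cong :: "('a \<times> 'a) set \<Rightarrow> ('a list \<times> 'a list) set"
  for I :: "('a \<times> 'a) set" where
  commute: "(a, b) \<in> I \<Longrightarrow> ([a, b], [b, a]) \<in> trace_cong I"
| refl: "(u, u) \<in> trace_cong I"
| sym: "(u, v) \<in> trace_cong I \<Longrightarrow> (v, u) \<in> trace_cong I"
| trans: "(u, v) \<in> trace_cong I \<Longrightarrow> (v, w) \<in> trace_cong I \<Longrightarrow> (u, w) \<in> trace_cong I"
| append: "(u, u') \<in> trace_cong I \<Longrightarrow> (v, v') \<in> trace_cong I \<Longrightarrow> (u @ v, u' @ v') \<in> trace_cong I"

definition trace_of :: "('a \<times> 'a) set \<Rightarrow> 'a list \<Rightarrow> 'a trace" where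
  "trace_of I w = trace_cong I `` {w}"

definition trace_monoid :: "('a \<times> 'a) set \<Rightarrow> 'a trace monoid" where
  "trace_monoid I =
    \<lparr>carrier = UNIV // trace_cong I,
     monoid.mult = (\<lambda>x y. trace_cong I `` {u @ v | u v. u \<in> x \<and> v \<in> y}),
     one = trace_of I []\<rparr>"

text \<open>Congruent words have the same length and the same letters, so both notions below are
  independent of the representative.\<close>

definition trace_length :: "'a trace \<Rightarrow> nat" where
  "trace_length x = the_elem (length ` x)"

definition trace_letters :: "'a trace \<Rightarrow> 'a set" where
  "trace_letters x = (\<Union>w\<in>x. set w)"

definition trace_le :: "('a \<times> 'a) set \<Rightarrow> 'a trace \<Rightarrow> 'a trace \<Rightarrow> bool" where
  "trace_le I x y \<longleftrightarrow> (\<exists>z\<in>carrier (trace_monoid I). y = x \<otimes>\<^bsub>trace_monoid I\<^esub> z)"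

definition irreducible_trace_monoid :: "('a \<times> 'a) set \<Rightarrow> bool" where
  "irreducible_trace_monoid I \<longleftrightarrow> (\<forall>a b. (a, b) \<in> (UNIV \<times> UNIV - I)\<^sup>*)"

definition cliques :: "('a \<times> 'a) set \<Rightarrow> 'a trace set" where
  "cliques I =
    {trace_of I w | w. \<forall>i<length w. \<forall>j<length w. i \<noteq> j \<longrightarrow> (w ! i, w ! j) \<in> I}"

definition clique_arrow :: "('a \<times> 'a) set \<Rightarrow> 'a trace \<Rightarrow> 'a trace \<Rightarrow> bool" where
  "clique_arrow I c d \<longleftrightarrow> (\<forall>b\<in>trace_letters d. \<exists>a\<in>trace_letters c. (a, b) \<notin> I)"

text \<open>Sequences are indexed from 0, so \<open>\<omega> i\<close> stands for $C_{i+1}(\omega)$.\<close>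

type_synonym 'a inf_trace = "nat \<Rightarrow> 'a trace"

definition boundary :: "('a \<times> 'a) set \<Rightarrow> 'a inf_trace set" where
  "boundary I =
    {\<omega>. \<forall>i. \<omega> i \<in> cliques I \<and> \<omega> i \<noteq> \<one>\<^bsub>trace_monoid I\<^esub> \<and> clique_arrow I (\<omega> i) (\<omega> (Suc i))}"

text \<open>The topology on the boundary is the one induced by the product of the discrete topologies
  on the finite set of cliques.\<close>

definition boundary_topology :: "('a \<times> 'a) set \<Rightarrow> 'a inf_trace topology" where
  "boundary_topology I =
    subtopology (product_topology (\<lambda>_. discrete_topology (cliques I)) UNIV) (boundary I)"

definition boundary_borel :: "('a \<times> 'a) set \<Rightarrow> 'a inf_trace measure" where
  "boundary_borel I = sigma (boundary I) {U. openin (boundary_topology I) U}"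

text \<open>\<open>inf_prefix I \<omega> n\<close> is $C_1(\omega)\cdots C_n(\omega)$.\<close>

primrec inf_prefix :: "('a \<times> 'a) set \<Rightarrow> 'a inf_trace \<Rightarrow> nat \<Rightarrow> 'a trace" where
  "inf_prefix I \<omega> 0 = \<one>\<^bsub>trace_monoid I\<^esub>"
| "inf_prefix I \<omega> (Suc n) = inf_prefix I \<omega> n \<otimes>\<^bsub>trace_monoid I\<^esub> \<omega> n"

definition inf_trace_le :: "('a \<times> 'a) set \<Rightarrow> 'a trace \<Rightarrow> 'a inf_trace \<Rightarrow> bool" where
  "inf_trace_le I x \<omega> \<longleftrightarrow> (\<exists>n. trace_le I x (inf_prefix I \<omega> n))"

definition cylinder :: "('a \<times> 'a) set \<Rightarrow> 'a trace \<Rightarrow> 'a inf_trace set" where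
  "cylinder I x = {\<omega> \<in> boundary I. inf_trace_le I x \<omega>}"

text \<open>The finite type \<open>'s\<close> is the set of states and \<open>None\<close> is the sink state $\bot$. The action is
  only constrained on the carrier of the trace monoid.\<close>

definition concurrent_system ::
    "('a::finite \<times> 'a) set \<Rightarrow> ('s::finite option \<Rightarrow> 'a trace \<Rightarrow> 's option) \<Rightarrow> bool" where
  "concurrent_system I act \<longleftrightarrow>
    irrefl I \<and> sym I \<and>
    (\<forall>p. act p \<one>\<^bsub>trace_monoid I\<^esub> = p) \<and>
    (\<forall>p. \<forall>x\<in>carrier (trace_monoid I). \<forall>y\<in>carrier (trace_monoid I).
      act p (x \<otimes>\<^bsub>trace_monoid I\<^esub> y) = act (act p x) y) \<and>
    (\<forall>x\<in>carrier (trace_monoid I). act None x = None)"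

definition traces_from ::
    "('a \<times> 'a) set \<Rightarrow> ('s option \<Rightarrow> 'a trace \<Rightarrow> 's option) \<Rightarrow> 's \<Rightarrow> 'a trace set" where
  "traces_from I act \<alpha> = {x \<in> carrier (trace_monoid I). act (Some \<alpha>) x \<noteq> None}"

definition traces_between ::
    "('a \<times> 'a) set \<Rightarrow> ('s option \<Rightarrow> 'a trace \<Rightarrow> 's option) \<Rightarrow> 's \<Rightarrow> 's \<Rightarrow> 'a trace set" where
  "traces_between I act \<alpha> \<beta> = {x \<in> carrier (trace_monoid I). act (Some \<alpha>) x = Some \<beta>}"

definition cliques_between ::
    "('a \<times> 'a) set \<Rightarrow> ('s option \<Rightarrow> 'a trace \<Rightarrow> 's option) \<Rightarrow> 's \<Rightarrow> 's \<Rightarrow> 'a trace set" where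
  "cliques_between I act \<alpha> \<beta> = cliques I \<inter> traces_between I act \<alpha> \<beta>"

definition boundary_from ::
    "('a \<times> 'a) set \<Rightarrow> ('s option \<Rightarrow> 'a trace \<Rightarrow> 's option) \<Rightarrow> 's \<Rightarrow> 'a inf_trace set" where
  "boundary_from I act \<alpha> =
    {\<omega> \<in> boundary I. \<forall>x\<in>carrier (trace_monoid I). inf_trace_le I x \<omega> \<longrightarrow> x \<in> traces_from I act \<alpha>}"

definition nontrivial_system ::
    "('a \<times> 'a) set \<Rightarrow> ('s option \<Rightarrow> 'a trace \<Rightarrow> 's option) \<Rightarrow> bool" where
  "nontrivial_system I act \<longleftrightarrow> (\<exists>\<alpha> a. act (Some \<alpha>) (trace_of I [a]) \<noteq> None)"

definition transitive_system ::
    "('a \<times> 'a) set \<Rightarrow> ('s option \<Rightarrow> 'a trace \<Rightarrow> 's option) \<Rightarrow> bool" where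
  "transitive_system I act \<longleftrightarrow> (\<forall>\<alpha> \<beta>. traces_between I act \<alpha> \<beta> \<noteq> {})"

definition irreducible_system ::
    "('a::finite \<times> 'a) set \<Rightarrow> ('s::finite option \<Rightarrow> 'a trace \<Rightarrow> 's option) \<Rightarrow> bool" where
  "irreducible_system I act \<longleftrightarrow>
    concurrent_system I act \<and>
    transitive_system I act \<and> nontrivial_system I act \<and>
    irreducible_trace_monoid I \<and>
    (\<forall>\<alpha> a. \<exists>u\<in>carrier (trace_monoid I).
      act (Some \<alpha>) (u \<otimes>\<^bsub>trace_monoid I\<^esub> trace_of I [a]) \<noteq> None)"

definition valuation ::
    "('a \<times> 'a) set \<Rightarrow> ('s option \<Rightarrow> 'a trace \<Rightarrow> 's option) \<Rightarrow> ('s \<Rightarrow> 'a trace \<Rightarrow> real) \<Rightarrow> bool" where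
  "valuation I act f \<longleftrightarrow>
    (\<forall>\<alpha>. \<forall>x\<in>carrier (trace_monoid I). 0 \<le> f \<alpha> x \<and> (f \<alpha> x > 0 \<longleftrightarrow> act (Some \<alpha>) x \<noteq> None)) \<and>
    (\<forall>\<alpha>. \<forall>x\<in>carrier (trace_monoid I). \<forall>y\<in>carrier (trace_monoid I).
      f \<alpha> (x \<otimes>\<^bsub>trace_monoid I\<^esub> y) =
        (case act (Some \<alpha>) x of None \<Rightarrow> 0 | Some \<beta> \<Rightarrow> f \<alpha> x * f \<beta> y))"

definition markov_measure ::
    "('a \<times> 'a) set \<Rightarrow> ('s option \<Rightarrow> 'a trace \<Rightarrow> 's option) \<Rightarrow> ('s \<Rightarrow> 'a inf_trace measure) \<Rightarrow> bool" where
  "markov_measure I act m \<longleftrightarrow>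
    (\<forall>\<alpha>. prob_space (m \<alpha>) \<and> sets (m \<alpha>) = sets (boundary_borel I) \<and>
      measure (m \<alpha>) (boundary_from I act \<alpha>) = 1) \<and>
    (\<forall>\<alpha>. \<forall>x\<in>carrier (trace_monoid I).
      x \<in> traces_from I act \<alpha> \<longleftrightarrow> measure (m \<alpha>) (cylinder I x) > 0) \<and>
    (\<forall>\<alpha>. \<forall>x\<in>carrier (trace_monoid I). \<forall>y\<in>carrier (trace_monoid I).
      measure (m \<alpha>) (cylinder I (x \<otimes>\<^bsub>trace_monoid I\<^esub> y)) =
        (case act (Some \<alpha>) x of None \<Rightarrow> 0
         | Some \<beta> \<Rightarrow> measure (m \<alpha>) (cylinder I x) * measure (m \<beta>) (cylinder I y)))"

definition probabilistic_valuation ::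
    "('a \<times> 'a) set \<Rightarrow> ('s option \<Rightarrow> 'a trace \<Rightarrow> 's option) \<Rightarrow> ('s \<Rightarrow> 'a trace \<Rightarrow> real) \<Rightarrow> bool" where
  "probabilistic_valuation I act f \<longleftrightarrow>
    valuation I act f \<and>
    (\<exists>m. markov_measure I act m \<and>
      (\<forall>\<alpha>. \<forall>x\<in>carrier (trace_monoid I). f \<alpha> x = measure (m \<alpha>) (cylinder I x)))"

definition positive_cocycle :: "('s \<Rightarrow> 's \<Rightarrow> real) \<Rightarrow> bool" where
  "positive_cocycle \<Delta> \<longleftrightarrow>
    (\<forall>\<alpha> \<beta>. \<Delta> \<alpha> \<beta> > 0) \<and> (\<forall>\<alpha> \<beta> \<gamma>. \<Delta> \<alpha> \<gamma> = \<Delta> \<alpha> \<beta> * \<Delta> \<beta> \<gamma>)"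

text \<open>The family $\rho^{|x|}\Delta(\alpha,\alpha\cdot x) f_\alpha(x)$, set to 0 where
  $\alpha\cdot x=\bot$; a valuation \<open>f\<close> vanishes there as well.\<close>

definition twisted ::
    "('s option \<Rightarrow> 'a trace \<Rightarrow> 's option) \<Rightarrow> real \<Rightarrow> ('s \<Rightarrow> 's \<Rightarrow> real) \<Rightarrow>
      ('s \<Rightarrow> 'a trace \<Rightarrow> real) \<Rightarrow> 's \<Rightarrow> 'a trace \<Rightarrow> real" where
  "twisted act \<rho> \<Delta> f \<alpha> x =
    (case act (Some \<alpha>) x of None \<Rightarrow> 0 | Some \<beta> \<Rightarrow> \<rho> ^ trace_length x * \<Delta> \<alpha> \<beta> * f \<alpha> x)"

definition moebius_matrix ::
    "('a \<times> 'a) set \<Rightarrow> ('s option \<Rightarrow> 'a trace \<Rightarrow> 's option) \<Rightarrow> ('s \<Rightarrow> 'a trace \<Rightarrow> real) \<Rightarrow>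
      real poly ^ 's ^ 's" where
  "moebius_matrix I act f =
    (\<chi> \<alpha> \<beta>. \<Sum>c\<in>cliques_between I act \<alpha> \<beta>.
      monom ((- 1) ^ trace_length c * f \<alpha> c) (trace_length c))"

definition moebius_det ::
    "('a \<times> 'a) set \<Rightarrow> ('s::finite option \<Rightarrow> 'a trace \<Rightarrow> 's option) \<Rightarrow> ('s \<Rightarrow> 'a trace \<Rightarrow> real) \<Rightarrow>
      real poly" where
  "moebius_det I act f = det (moebius_matrix I act f)"

definition matrix_eval :: "'r::comm_semiring_0 poly ^ 'n ^ 'm \<Rightarrow> 'r \<Rightarrow> 'r ^ 'n ^ 'm" where
  "matrix_eval A t = (\<chi> i j. poly (A $ i $ j) t)"

end

theory Submission
  imports Defs
begin

text \<open>
  Let \<open>m\<close> be the Markov measure behind the twisted valuation, and call \<open>m \<alpha> (\<up>x)\<close> the weight of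
  \<open>x\<close> at \<open>\<alpha>\<close>.  Writing \<open>\<Delta> \<alpha> \<beta> = U \<beta> / U \<alpha>\<close>, conjugation by the diagonal matrix of \<open>U\<close> turns the
  Moebius matrix at \<open>\<rho> t\<close> into the Moebius matrix of the weights at \<open>t\<close> (\<open>moebius_row\<close>).  The
  claims become: at \<open>t = 1\<close> the kernel of the latter consists of the constant vectors, and for
  complex \<open>t\<close> with \<open>|t| < 1\<close> it is trivial.

  Constants lie in the kernel by inclusion-exclusion (\<open>moebius_weight\<close>): the cliques below an
  infinite trace are the subsets of its non-empty set of initial letters, so their signs cancel
  pointwise, and the integral of the cancelled sum is the alternating sum of the weights.

  For the converse the signs in the Moebius matrix have to be removed, since no maximum principle
  applies to them.  Fix a letter \<open>a\<close> and multiply the Moebius matrix on the left by the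
  generating matrix of the traces that do not contain \<open>a\<close>.  Nearly all terms cancel; what remains
  is the identity minus the generating matrix of the pyramids, the traces with exactly one \<open>a\<close> in
  which \<open>a\<close> is the only final letter (\<open>pyramidal_expansion\<close>).  Hence a kernel vector \<open>v\<close> satisfies
  \<open>v \<alpha> = (\<Sum>x. weight \<alpha> x * t ^ |x| * v (\<alpha> \<cdot> x))\<close>, where \<open>x\<close> ranges over the pyramids
  (\<open>kernel_has_sum\<close>).  These coefficients are nonnegative at \<open>t = 1\<close> and add up to 1, because
  the constant vector 1 is in the kernel.  If \<open>|t| < 1\<close>, the equation is a strict contraction and
  \<open>v = 0\<close>.  If \<open>t = 1\<close>, a maximal value of \<open>v\<close> spreads along every enabled letter, as a single
  letter is a pyramid, and transitivity makes \<open>v\<close> constant.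

  The multiplication is legitimate up to the boundary \<open>|t| = 1\<close> because the weights of the
  \<open>a\<close>-free traces are summable (\<open>summable_avoiding\<close>).  This is where the connectedness of the
  dependence graph is needed, together with the fact that no letter dies out: every state enables
  a word \<open>w\<close> such that all letters of \<open>z w\<close>, for any \<open>a\<close>-free \<open>z\<close>, come before or at the last \<open>a\<close>
  (\<open>sealing_word\<close>).  An infinite trace above \<open>z w\<close> therefore determines \<open>z w\<close> from
  the number of letters \<open>a\<close> in \<open>w\<close> (\<open>pyramid_unique\<close>), so the cylinders of the traces \<open>z w\<close>
  for which \<open>z\<close> leads to one given state are disjoint, and their measures add up to at most 1.
\<close>

section \<open>Preliminaries on sums, determinants and polynomials\<close>

lemma has_sum_sum:
  fixes f :: "'i \<Rightarrow> 'x \<Rightarrow> 'b::topological_comm_monoid_add"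
  assumes "\<And>i. i \<in> F \<Longrightarrow> (f i has_sum S i) A"
  shows "((\<lambda>x. \<Sum>i\<in>F. f i x) has_sum (\<Sum>i\<in>F. S i)) A"
  using assms by (induction F rule: infinite_finite_induct) (auto intro: has_sum_add)

lemma det_ring_hom:
  fixes A :: "'p::comm_ring_1 ^ 'n ^ 'n" and h :: "'p \<Rightarrow> 'q::comm_ring_1"
  assumes add: "\<And>x y. h (x + y) = h x + h y" and mult: "\<And>x y. h (x * y) = h x * h y"
    and one: "h 1 = 1"
  shows "h (det A) = det (\<chi> i j. h (A $ i $ j))"
proof -
  have zero: "h 0 = 0" using add[of 0 0] by simp
  have neg: "h (- x) = - h x" for x using add[of x "- x"] by (simp add: zero eq_neg_iff_add_eq_0 add.commute)
  have sum: "h (sum g F) = (\<Sum>x\<in>F. h (g x))" for g :: "('n \<Rightarrow> 'n) \<Rightarrow> 'p" and F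
    by (induction F rule: infinite_finite_induct) (auto simp: zero add)
  have prod: "h (prod g F) = (\<Prod>x\<in>F. h (g x))" for g :: "'n \<Rightarrow> 'p" and F
    by (induction F rule: infinite_finite_induct) (auto simp: one mult)
  have sgn: "h (of_int (sign p)) = of_int (sign p)" for p :: "'n \<Rightarrow> 'n"
    by (simp add: sign_def one neg)
  show ?thesis by (simp add: det_def sum prod mult sgn)
qed

lemma map_poly_of_real_add:
  "map_poly complex_of_real (p + q) = map_poly of_real p + map_poly of_real q"
  by (rule poly_eqI) (simp add: coeff_map_poly)

lemma map_poly_of_real_mult:
  "map_poly complex_of_real (p * q) = map_poly of_real p * map_poly of_real q"
  by (rule poly_eqI) (simp add: coeff_map_poly coeff_mult)

lemma map_poly_of_real_sum:
  "map_poly complex_of_real (\<Sum>x\<in>A. g x) = (\<Sum>x\<in>A. map_poly of_real (g x))"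
  by (induction A rule: infinite_finite_induct) (auto simp: map_poly_of_real_add)

lemma det_zero_kernel:
  fixes A :: "'p::field ^ 'n ^ 'n"
  shows "det A = 0 \<longleftrightarrow> (\<exists>v. v \<noteq> 0 \<and> A *v v = 0)"
  using invertible_det_nz[of A] invertible_left_inverse[of A] matrix_left_invertible_ker[of A]
  by blast

section \<open>Words up to commutation\<close>

locale independence =
  fixes I :: "('a \<times> 'a) set"
  assumes irrefl_I: "irrefl I" and sym_I: "sym I"
begin

definition cong_word :: "'a list \<Rightarrow> 'a list \<Rightarrow> bool" (infix "\<simeq>" 50) where
  "u \<simeq> v \<longleftrightarrow> (u, v) \<in> trace_cong I"

lemmas cong_induct [consumes 1, case_names commute refl sym trans append] =
  trace_cong.induct[of _ _ I, folded cong_word_def]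

lemma cong_commute: "(a, b) \<in> I \<Longrightarrow> [a, b] \<simeq> [b, a]"
  by (simp add: cong_word_def trace_cong.commute)

abbreviation indep :: "'a \<Rightarrow> 'a list \<Rightarrow> bool" where
  "indep b u \<equiv> \<forall>c\<in>set u. (b, c) \<in> I"

lemma cong_refl [simp, intro]: "u \<simeq> u"
  by (simp add: cong_word_def trace_cong.refl)

lemma cong_sym: "u \<simeq> v \<Longrightarrow> v \<simeq> u"
  unfolding cong_word_def by (rule trace_cong.sym)

lemma cong_sym_iff: "u \<simeq> v \<longleftrightarrow> v \<simeq> u"
  by (rule iffI; rule cong_sym)

lemma cong_trans [trans]: "u \<simeq> v \<Longrightarrow> v \<simeq> w \<Longrightarrow> u \<simeq> w"
  unfolding cong_word_def by (rule trace_cong.trans)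

lemma cong_append: "u \<simeq> u' \<Longrightarrow> v \<simeq> v' \<Longrightarrow> u @ v \<simeq> u' @ v'"
  by (simp add: cong_word_def trace_cong.append)

lemma cong_Cons: "u \<simeq> v \<Longrightarrow> b # u \<simeq> b # v"
  using cong_append[of "[b]" "[b]" u v] by simp

lemma cong_mset: "u \<simeq> v \<Longrightarrow> mset u = mset v"
  by (induction rule: cong_induct) auto

lemma cong_length: "u \<simeq> v \<Longrightarrow> length u = length v"
  by (metis cong_mset size_mset)

lemma cong_set: "u \<simeq> v \<Longrightarrow> set u = set v"
  by (metis cong_mset set_mset_mset)

lemma cong_count: "u \<simeq> v \<Longrightarrow> count_list u a = count_list v a"
  by (metis cong_mset count_mset)

lemma cong_Nil [simp]: "u \<simeq> [] \<longleftrightarrow> u = []" "[] \<simeq> u \<longleftrightarrow> u = []"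
  using cong_length by fastforce+

lemma cong_rev: "u \<simeq> v \<Longrightarrow> rev u \<simeq> rev v"
proof (induction rule: cong_induct)
  case (commute a b)
  then have "(b, a) \<in> I" using sym_I by (auto dest: symD)
  then show ?case using cong_commute by fastforce
next
  case (sym u v) show ?case by (rule cong_sym[OF sym.IH])
next
  case (trans u v w) show ?case by (rule cong_trans[OF trans.IH])
next
  case (append u u' v v') then show ?case using cong_append by simp
qed auto

lemma cong_rev_iff: "rev u \<simeq> rev v \<longleftrightarrow> u \<simeq> v"
  using cong_rev[of "rev u" "rev v"] cong_rev[of u v] by auto

text \<open>Occurrences of one letter never commute past each other, so the first \<open>b\<close> of a word can be
  followed through all commutations.  Deleting it undoes a multiplication by \<open>b\<close>; this is where
  cancellation comes from.\<close>

lemma cong_remove1: "u \<simeq> v \<Longrightarrow> remove1 b u \<simeq> remove1 b v"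
proof (induction rule: cong_induct)
  case (commute c d)
  have "[c, d] \<simeq> [d, c]" using commute by (rule cong_commute)
  then show ?case by auto
next
  case (sym u v) show ?case by (rule cong_sym[OF sym.IH])
next
  case (trans u v w) show ?case by (rule cong_trans[OF trans.IH])
next
  case (append u u' v v')
  then show ?case by (auto simp: remove1_append cong_set[of u u'] intro!: cong_append)
qed auto

lemma cong_Cons_cancel: "b # u \<simeq> b # v \<longleftrightarrow> u \<simeq> v"
  using cong_remove1[of "b # u" "b # v" b] cong_Cons by auto

lemma cong_append_cancel_left: "w @ u \<simeq> w @ v \<longleftrightarrow> u \<simeq> v"
  by (induction w) (auto simp: cong_Cons_cancel)

lemma cong_append_cancel_right: "u @ w \<simeq> v @ w \<longleftrightarrow> u \<simeq> v"
  using cong_append_cancel_left[of "rev w" "rev u" "rev v"] cong_rev_iff by (metis rev_append)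

lemma cong_indep_commute: "indep b u \<Longrightarrow> u @ [b] \<simeq> b # u"
proof (induction u)
  case (Cons c u)
  have "(c, b) \<in> I" using Cons.prems sym_I by (auto dest: symD)
  then have "[c, b] @ u \<simeq> [b, c] @ u" by (intro cong_append cong_commute) auto
  then have 1: "c # (b # u) \<simeq> b # (c # u)" by simp
  have "c # (u @ [b]) \<simeq> c # (b # u)" using Cons by (intro cong_Cons) auto
  then show ?case using cong_trans[OF _ 1] by simp
qed auto

definition can_start :: "'a \<Rightarrow> 'a list \<Rightarrow> bool" where
  "can_start b u \<longleftrightarrow> b \<in> set u \<and> indep b (takeWhile (\<lambda>c. c \<noteq> b) u)"

lemma can_start_Cons: "can_start b (c # u) \<longleftrightarrow> b = c \<or> (b, c) \<in> I \<and> can_start b u"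
  using irrefl_I by (auto simp: can_start_def irrefl_def)

lemma can_start_append:
  "can_start b (u @ v) \<longleftrightarrow> can_start b u \<or> indep b u \<and> can_start b v"
  by (induction u) (auto simp: can_start_Cons can_start_def[of _ "[]"])

lemma indep_not_in: "indep b u \<Longrightarrow> b \<notin> set u"
  using irrefl_I by (auto simp: irrefl_def)

lemma can_start_cong: "u \<simeq> v \<Longrightarrow> can_start b u \<longleftrightarrow> can_start b v"
proof (induction rule: cong_induct)
  case (commute c d)
  then show ?case using sym_I by (auto simp: can_start_def dest: symD)
next
  case (append u u' v v')
  then show ?case by (simp add: can_start_append cong_set[of u u'])
qed auto

lemma can_start_remove1: "can_start b u \<Longrightarrow> u \<simeq> b # remove1 b u"
proof (induction u)
  case (Cons c u)
  show ?case
  proof (cases "b = c")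
    case False
    then have cI: "(b, c) \<in> I" "can_start b u" using Cons.prems by (auto simp: can_start_Cons)
    have "c # u \<simeq> c # (b # remove1 b u)" using Cons.IH cI by (intro cong_Cons) auto
    also have "\<dots> = [c, b] @ remove1 b u" by simp
    also have "\<dots> \<simeq> [b, c] @ remove1 b u"
      using cI sym_I by (intro cong_append cong_commute) (auto dest: symD)
    finally show ?thesis using False by auto
  qed auto
qed (simp add: can_start_def)

lemma can_start_iff: "can_start b u \<longleftrightarrow> (\<exists>v. u \<simeq> b # v)"
  using can_start_cong can_start_remove1 can_start_Cons by blast

section \<open>Cliques and initial letters of words\<close>

definition clique_word :: "'a list \<Rightarrow> bool" where
  "clique_word w \<longleftrightarrow> (\<forall>i<length w. \<forall>j<length w. i \<noteq> j \<longrightarrow> (w ! i, w ! j) \<in> I)"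

lemma clique_word_iff:
  "clique_word w \<longleftrightarrow> distinct w \<and> (\<forall>b\<in>set w. \<forall>c\<in>set w. b \<noteq> c \<longrightarrow> (b, c) \<in> I)"
  unfolding clique_word_def distinct_conv_nth using irrefl_I
  by (fastforce simp: in_set_conv_nth irrefl_def)

lemma clique_word_Cons: "clique_word (b # w) \<longleftrightarrow> indep b w \<and> clique_word w"
  using irrefl_I sym_I by (auto simp: clique_word_iff irrefl_def dest: symD)

lemma can_start_clique: "clique_word w \<Longrightarrow> b \<in> set w \<Longrightarrow> can_start b w"
  by (induction w) (auto simp: clique_word_Cons can_start_Cons dest: symD[OF sym_I])

text \<open>Two different initial letters of a word are unordered, so they commute, and each remains
  initial after removal of the other.  Hence the cliques that divide a word on the left are
  exactly the subsets of its set of initial letters.\<close>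

lemma clique_prefix_iff:
  assumes "clique_word w"
  shows "(\<exists>v. u \<simeq> w @ v) \<longleftrightarrow> (\<forall>b\<in>set w. can_start b u)"
proof
  assume "\<exists>v. u \<simeq> w @ v"
  then show "\<forall>b\<in>set w. can_start b u"
    using assms can_start_clique can_start_cong can_start_append by blast
next
  assume "\<forall>b\<in>set w. can_start b u"
  with assms show "\<exists>v. u \<simeq> w @ v"
  proof (induction w arbitrary: u)
    case Nil show ?case by (auto intro: exI[of _ u])
  next
    case (Cons b w)
    define u' where "u' = remove1 b u"
    have u': "u \<simeq> b # u'" using Cons.prems(2) can_start_remove1 by (auto simp: u'_def)
    have "can_start c u'" if "c \<in> set w" for c
    proof -
      have "can_start c (b # u')" using that Cons.prems(2) u' can_start_cong by auto
      moreover have "c \<noteq> b" using that Cons.prems(1) indep_not_in by (auto simp: clique_word_Cons)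
      ultimately show ?thesis by (auto simp: can_start_Cons)
    qed
    then have "\<exists>v. u' \<simeq> w @ v"
      using Cons.IH Cons.prems(1) by (simp add: clique_word_Cons)
    then obtain v where "u' \<simeq> w @ v" by blast
    then have "b # u' \<simeq> (b # w) @ v" using cong_Cons by auto
    then show ?case using u' cong_trans by blast
  qed
qed

lemma can_start_indep: "can_start b u \<Longrightarrow> can_start c u \<Longrightarrow> b \<noteq> c \<Longrightarrow> (b, c) \<in> I"
  by (induction u) (auto simp: can_start_Cons can_start_def[of _ "[]"] dest: symD[OF sym_I])

lemma clique_word_cong: "clique_word w \<Longrightarrow> clique_word w' \<Longrightarrow> set w = set w' \<Longrightarrow> w \<simeq> w'"
proof -
  assume w: "clique_word w" "clique_word w'" "set w = set w'"
  then obtain v where v: "w' \<simeq> w @ v" using clique_prefix_iff can_start_clique by metis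
  moreover have "length w = length w'" using w by (metis clique_word_iff distinct_card)
  ultimately have "v = []" using cong_length by fastforce
  then show ?thesis using v cong_sym by simp
qed

lemma clique_word_rev: "clique_word (rev w) \<longleftrightarrow> clique_word w"
  by (simp add: clique_word_iff)

lemma finite_clique_exists:
  assumes "finite B" "\<And>b c. b \<in> B \<Longrightarrow> c \<in> B \<Longrightarrow> b \<noteq> c \<Longrightarrow> (b, c) \<in> I"
  shows "\<exists>w. clique_word w \<and> set w = B"
  using finite_distinct_list[OF assms(1)] assms(2) by (auto simp: clique_word_iff)

section \<open>Pyramids\<close>

text \<open>Pyramids in the sense of heaps of pieces, with an apex labelled \<open>a\<close>: reversing the word
  turns initial letters into final ones.  The empty word is included, which lets inductions strip
  letters from the front.\<close>

definition pyramid :: "'a \<Rightarrow> 'a list \<Rightarrow> bool" where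
  "pyramid a u \<longleftrightarrow> (\<forall>c. can_start c (rev u) \<longrightarrow> c = a)"

lemma can_end_iff: "can_start c (rev u) \<longleftrightarrow> (\<exists>v. u \<simeq> v @ [c])"
  by (metis can_start_iff cong_rev_iff rev.simps(2) rev_rev_ident)

lemma pyramid_cong: "u \<simeq> v \<Longrightarrow> pyramid a u \<longleftrightarrow> pyramid a v"
  by (auto simp: pyramid_def can_start_cong[OF cong_rev])

lemma pyramid_ConsD: "pyramid a (b # u) \<Longrightarrow> pyramid a u"
  by (auto simp: pyramid_def can_start_append)

lemma pyramid_no_top: "pyramid a u \<Longrightarrow> a \<notin> set u \<Longrightarrow> u = []"
  by (cases u rule: rev_cases) (auto simp: pyramid_def can_start_Cons)

text \<open>A pyramid is the past of its last \<open>a\<close>.  In a common multiple of two words the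
  occurrences of \<open>a\<close> are linearly ordered, so the past of an earlier one lies inside any prefix
  that contains at least as many letters \<open>a\<close>.\<close>

lemma pyramid_prefix:
  assumes "pyramid a x" "x @ u \<simeq> y @ v" "count_list x a \<le> count_list y a"
  shows "\<exists>r. y \<simeq> x @ r"
  using assms
proof (induction y arbitrary: x u)
  case Nil
  then have "a \<notin> set x" by (auto simp: count_list_0_iff)
  then show ?case using pyramid_no_top Nil by auto
next
  case (Cons b y)
  have b: "can_start b (x @ u)"
    using can_start_cong[OF Cons.prems(2)] by (simp add: can_start_Cons)
  show ?case
  proof (cases "can_start b x")
    case True
    define x' where "x' = remove1 b x"
    have x': "x \<simeq> b # x'" using True can_start_remove1 by (simp add: x'_def)
    have "(b # x') @ u \<simeq> x @ u" by (intro cong_append cong_sym[OF x'] cong_refl)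
    also have "\<dots> \<simeq> (b # y) @ v" by (rule Cons.prems(2))
    finally have "b # (x' @ u) \<simeq> b # (y @ v)" by simp
    then have "x' @ u \<simeq> y @ v" by (simp add: cong_Cons_cancel)
    moreover have "pyramid a x'" using Cons.prems(1) x' pyramid_cong pyramid_ConsD by blast
    moreover have "count_list x' a \<le> count_list y a"
      using Cons.prems(3) cong_count[OF x', of a] by (auto split: if_splits)
    ultimately obtain r where "y \<simeq> x' @ r" using Cons.IH by blast
    then have "b # y \<simeq> (b # x') @ r" using cong_Cons by auto
    also have "\<dots> \<simeq> x @ r" using x' by (intro cong_append cong_sym[OF x']) auto
    finally show ?thesis by blast
  next
    \<comment> \<open>Then \<open>b\<close> commutes with all of \<open>x\<close> and comes from \<open>u\<close>; removing it leaves \<open>x\<close> unchanged.\<close>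
    case False
    then have bx: "indep b x" and bu: "can_start b u" using b by (auto simp: can_start_append)
    define u' where "u' = remove1 b u"
    have u': "u \<simeq> b # u'" using bu can_start_remove1 by (simp add: u'_def)
    show ?thesis
    proof (cases "b = a")
      case True
      then have "x = []" using bx indep_not_in pyramid_no_top Cons.prems(1) by blast
      then show ?thesis by auto
    next
      case False
      have "b # (x @ u') = (b # x) @ u'" by simp
      also have "\<dots> \<simeq> (x @ [b]) @ u'"
        using cong_indep_commute[OF bx] by (intro cong_append cong_sym[of "x @ [b]"]) auto
      also have "\<dots> = x @ (b # u')" by simp
      also have "\<dots> \<simeq> x @ u" by (intro cong_append cong_sym[OF u']) auto
      also have "\<dots> \<simeq> b # (y @ v)" using Cons.prems(2) by simp
      finally have "x @ u' \<simeq> y @ v" by (simp add: cong_Cons_cancel)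
      moreover have "count_list x a \<le> count_list y a" using Cons.prems(3) False by auto
      ultimately obtain r where "y \<simeq> x @ r" using Cons.IH Cons.prems(1) by blast
      then have "b # y \<simeq> b # (x @ r)" by (rule cong_Cons)
      also have "b # (x @ r) = (b # x) @ r" by simp
      also have "\<dots> \<simeq> (x @ [b]) @ r"
        using cong_indep_commute[OF bx] by (intro cong_append cong_sym[of "x @ [b]"]) auto
      finally show ?thesis by auto
    qed
  qed
qed

lemma pyramid_unique:
  assumes "pyramid a x" "pyramid a y" "x @ u \<simeq> y @ v" "count_list x a = count_list y a"
  shows "x \<simeq> y"
proof -
  obtain r where r: "y \<simeq> x @ r" using pyramid_prefix[OF assms(1,3)] assms(4) by auto
  obtain s where s: "x \<simeq> y @ s" using pyramid_prefix[OF assms(2) cong_sym[OF assms(3)]] assms(4) by auto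
  have "r = []" using cong_length[OF r] cong_length[OF s] by simp
  then show ?thesis using r cong_sym by simp
qed

text \<open>The letters that, when written in front of \<open>w\<close>, come before some \<open>a\<close> of \<open>w\<close> in the
  trace order; the parameter \<open>S\<close> collects the letters with this property for the word that
  follows \<open>w\<close>.\<close>

primrec below :: "'a \<Rightarrow> 'a set \<Rightarrow> 'a list \<Rightarrow> 'a set" where
  "below a S [] = S"
| "below a S (c # w) =
    below a S w \<union> (if c = a \<or> c \<in> below a S w then {b. (b, c) \<notin> I} else {})"

lemma below_append: "below a S (u @ v) = below a (below a S v) u"
  by (induction u) auto

lemma below_mono: "S \<subseteq> T \<Longrightarrow> below a S w \<subseteq> below a T w"
  by (induction w) auto

lemma below_increasing: "S \<subseteq> below a S w"
  by (induction w) auto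

lemma below_cong: "u \<simeq> v \<Longrightarrow> below a S u = below a S v"
proof (induction arbitrary: S rule: cong_induct)
  case (commute c d)
  then have "(d, c) \<in> I" using sym_I by (auto dest: symD)
  then show ?case using commute by auto
next
  case (append u u' v v') then show ?case by (simp add: below_append)
qed simp_all

lemma below_dependent: "b \<in> below a {} w \<Longrightarrow> \<exists>c\<in>set w. (b, c) \<notin> I"
  by (induction w) (auto split: if_splits)

text \<open>A final letter of \<open>z w\<close> that does not occur in \<open>w\<close> would have to commute with all of
  \<open>w\<close>.\<close>

lemma pyramid_append:
  assumes "pyramid a w" "below a {} w = UNIV"
  shows "pyramid a (z @ w)"
  using assms below_dependent[of _ a w]
  by (auto simp: pyramid_def can_start_append)

end

section \<open>Traces and cliques\<close>

locale finite_independence = independence I for I :: "('a::finite \<times> 'a) set"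
begin

abbreviation M :: "'a trace monoid" where "M \<equiv> trace_monoid I"

lemma equiv_trace_cong: "equiv UNIV (trace_cong I)"
  by (rule equivI)
     (auto simp: refl_on_def intro: trace_cong.refl symI trace_cong.sym transI trace_cong.trans)

lemma trace_of_eq_iff: "trace_of I u = trace_of I v \<longleftrightarrow> u \<simeq> v"
  unfolding trace_of_def cong_word_def
  using eq_equiv_class_iff[OF equiv_trace_cong] by auto

lemma in_trace_of: "v \<in> trace_of I u \<longleftrightarrow> u \<simeq> v"
  by (auto simp: trace_of_def cong_word_def)

lemma carrier_eq: "carrier M = range (trace_of I)"
  by (auto simp: trace_monoid_def trace_of_def quotient_def)

lemma trace_of_carrier [simp, intro]: "trace_of I u \<in> carrier M"
  by (auto simp: carrier_eq)

lemma one_eq: "\<one>\<^bsub>M\<^esub> = trace_of I []"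
  by (simp add: trace_monoid_def)

lemma mult_trace_of [simp]: "trace_of I u \<otimes>\<^bsub>M\<^esub> trace_of I v = trace_of I (u @ v)"
proof -
  have "trace_cong I `` {u' @ v' | u' v'. u' \<in> trace_of I u \<and> v' \<in> trace_of I v}
      = trace_of I (u @ v)"
  proof (rule equalityI; rule subsetI)
    fix w
    assume "w \<in> trace_cong I `` {u' @ v' | u' v'. u' \<in> trace_of I u \<and> v' \<in> trace_of I v}"
    then obtain u' v' where "u \<simeq> u'" "v \<simeq> v'" "u' @ v' \<simeq> w"
      by (auto simp: in_trace_of cong_word_def)
    then have "u @ v \<simeq> w" by (rule cong_trans[OF cong_append])
    then show "w \<in> trace_of I (u @ v)" by (simp add: in_trace_of)
  next
    fix w
    assume "w \<in> trace_of I (u @ v)"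
    then have "(u @ v, w) \<in> trace_cong I" by (simp add: in_trace_of cong_word_def)
    then show "w \<in> trace_cong I `` {u' @ v' | u' v'. u' \<in> trace_of I u \<and> v' \<in> trace_of I v}"
      by (rule ImageI) (auto simp: in_trace_of)
  qed
  then show ?thesis by (simp add: trace_monoid_def)
qed

lemma mult_carrier [intro]: "x \<in> carrier M \<Longrightarrow> y \<in> carrier M \<Longrightarrow> x \<otimes>\<^bsub>M\<^esub> y \<in> carrier M"
  by (auto simp: carrier_eq)

lemma trace_length_of [simp]: "trace_length (trace_of I u) = length u"
proof -
  have "length ` trace_of I u = {length u}"
    using cong_length by (fastforce simp: in_trace_of)
  then show ?thesis by (simp add: trace_length_def)
qed

lemma trace_letters_of [simp]: "trace_letters (trace_of I u) = set u"
  using cong_set by (fastforce simp: trace_letters_def in_trace_of)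

lemma trace_le_of: "trace_le I (trace_of I u) (trace_of I v) \<longleftrightarrow> (\<exists>r. v \<simeq> u @ r)"
  by (auto simp: trace_le_def carrier_eq trace_of_eq_iff)

lemma cliques_eq: "cliques I = trace_of I ` {w. clique_word w}"
  by (auto simp: cliques_def clique_word_def)

lemma cliques_carrier: "c \<in> cliques I \<Longrightarrow> c \<in> carrier M"
  by (auto simp: cliques_eq)

lemma trace_length_clique: "c \<in> cliques I \<Longrightarrow> trace_length c = card (trace_letters c)"
  by (auto simp: cliques_eq clique_word_iff distinct_card)

lemma inj_on_trace_letters: "inj_on trace_letters (cliques I)"
  by (auto simp: inj_on_def cliques_eq trace_of_eq_iff intro: clique_word_cong)

lemma finite_cliques: "finite (cliques I)"
  using finite_imageD[OF _ inj_on_trace_letters] by simp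

lemma bij_betw_trace_letters:
  assumes "\<And>b c. b \<in> B \<Longrightarrow> c \<in> B \<Longrightarrow> b \<noteq> c \<Longrightarrow> (b, c) \<in> I"
  shows "bij_betw trace_letters {c \<in> cliques I. trace_letters c \<subseteq> B} (Pow B)"
proof (rule bij_betw_imageI)
  show "inj_on trace_letters {c \<in> cliques I. trace_letters c \<subseteq> B}"
    using inj_on_trace_letters by (rule inj_on_subset) auto
  have "\<exists>c\<in>cliques I. trace_letters c = S" if sub: "S \<subseteq> B" for S
  proof -
    obtain w where "clique_word w" "set w = S"
      using finite_clique_exists[of S] assms sub by (meson finite subsetD)
    then show ?thesis by (intro bexI[of _ "trace_of I w"]) (auto simp: cliques_eq)
  qed
  then have "Pow B \<subseteq> trace_letters ` {c \<in> cliques I. trace_letters c \<subseteq> B}"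
    by (simp add: image_iff subset_iff Bex_def) blast
  then show "trace_letters ` {c \<in> cliques I. trace_letters c \<subseteq> B} = Pow B" by auto
qed

text \<open>All cancellations below rest on this one: a clique is determined by its letters, so the sum
  runs over the subsets of \<open>B\<close>, half of which have even size unless \<open>B\<close> is empty.\<close>

lemma clique_alternating_sum:
  assumes "\<And>b c. b \<in> B \<Longrightarrow> c \<in> B \<Longrightarrow> b \<noteq> c \<Longrightarrow> (b, c) \<in> I"
  shows "(\<Sum>c\<in>{c \<in> cliques I. trace_letters c \<subseteq> B}. (- 1) ^ trace_length c :: 'b::comm_ring_1)
      = of_bool (B = {})"
proof -
  have "(\<Sum>c\<in>{c \<in> cliques I. trace_letters c \<subseteq> B}. (- 1) ^ trace_length c :: 'b)
      = (\<Sum>c\<in>{c \<in> cliques I. trace_letters c \<subseteq> B}. (- 1) ^ card (trace_letters c))"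
    by (rule sum.cong) (auto simp: trace_length_clique)
  also have "\<dots> = (\<Sum>S\<in>Pow B. (- 1) ^ card S)"
    by (rule sum.reindex_bij_betw[OF bij_betw_trace_letters[OF assms]]) auto
  also have "\<dots> = (\<Prod>b\<in>B. 1 - 1)"
    by (subst prod_diff_conv_sum) auto
  also have "\<dots> = of_bool (B = {})" by (simp add: card_gt_0_iff zero_power)
  finally show ?thesis .
qed

definition initials :: "'a list \<Rightarrow> 'a set" where
  "initials u = {b. can_start b u}"

lemma initials_indep: "b \<in> initials u \<Longrightarrow> c \<in> initials u \<Longrightarrow> b \<noteq> c \<Longrightarrow> (b, c) \<in> I"
  using can_start_indep by (auto simp: initials_def)

lemma initials_subset: "initials u \<subseteq> set u"
  by (auto simp: initials_def can_start_def)

lemma initials_empty_iff: "initials u = {} \<longleftrightarrow> u = []"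
  by (cases u) (auto simp: initials_def can_start_Cons can_start_def[of _ "[]"])

lemma clique_le_iff:
  assumes "c \<in> cliques I"
  shows "trace_le I c (trace_of I u) \<longleftrightarrow> trace_letters c \<subseteq> initials u"
  using assms clique_prefix_iff
  by (auto simp: cliques_eq trace_le_of initials_def subset_iff)

lemma clique_suffix_iff:
  assumes "c \<in> cliques I"
  shows "(\<exists>v. trace_of I v \<otimes>\<^bsub>M\<^esub> c = trace_of I u) \<longleftrightarrow> trace_letters c \<subseteq> initials (rev u)"
proof -
  obtain w where w: "clique_word w" "c = trace_of I w" using assms by (auto simp: cliques_eq)
  have "(\<exists>v. trace_of I v \<otimes>\<^bsub>M\<^esub> c = trace_of I u) \<longleftrightarrow> (\<exists>v. v @ w \<simeq> u)"
    using w by (simp add: trace_of_eq_iff)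
  also have "\<dots> \<longleftrightarrow> (\<exists>v. rev u \<simeq> rev w @ v)"
  proof -
    have "v @ w \<simeq> u \<longleftrightarrow> rev u \<simeq> rev w @ rev v" for v
      using cong_rev_iff[of u "v @ w"] cong_sym_iff[of u "v @ w"] by simp
    then show ?thesis by (metis rev_rev_ident)
  qed
  also have "\<dots> \<longleftrightarrow> trace_letters c \<subseteq> initials (rev u)"
    using clique_prefix_iff[of "rev w" "rev u"] w by (auto simp: clique_word_rev initials_def)
  finally show ?thesis .
qed

section \<open>The pyramidal expansion\<close>

definition avoiding :: "'a \<Rightarrow> 'a trace set" where
  "avoiding a = trace_of I ` {u. a \<notin> set u}"

definition pyramids :: "'a \<Rightarrow> 'a trace set" where
  "pyramids a = trace_of I ` {u. count_list u a = 1 \<and> pyramid a u}"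

lemma pyramids_iff: "trace_of I u \<in> pyramids a \<longleftrightarrow> count_list u a = 1 \<and> pyramid a u"
  using cong_count pyramid_cong by (force simp: pyramids_def trace_of_eq_iff)

lemma pyramid_iff: "pyramid a u \<longleftrightarrow> initials (rev u) \<subseteq> {a}"
  by (auto simp: pyramid_def initials_def)

lemma clique_factor_iff:
  assumes "c \<in> cliques I"
  shows "trace_of I u \<in> (\<lambda>z. z \<otimes>\<^bsub>M\<^esub> c) ` avoiding a \<longleftrightarrow>
    trace_letters c \<subseteq> initials (rev u) \<and> count_list u a = of_bool (a \<in> trace_letters c)"
proof -
  obtain w where w: "clique_word w" "c = trace_of I w" using assms by (auto simp: cliques_eq)
  then have cw: "count_list w a = of_bool (a \<in> trace_letters c)"
    using count_list_0_iff[of w a] distinct_count_atmost_1[of w]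
    by (auto simp: clique_word_iff simp flip: count_mset)
  have "trace_of I u \<in> (\<lambda>z. z \<otimes>\<^bsub>M\<^esub> c) ` avoiding a \<longleftrightarrow> (\<exists>v. a \<notin> set v \<and> u \<simeq> v @ w)"
    unfolding avoiding_def image_image using w by (auto simp: trace_of_eq_iff image_iff)
  also have "\<dots> \<longleftrightarrow> (\<exists>v. v @ w \<simeq> u) \<and> count_list u a = of_bool (a \<in> trace_letters c)"
  proof -
    have "a \<notin> set v \<longleftrightarrow> count_list u a = of_bool (a \<in> trace_letters c)" if "u \<simeq> v @ w" for v
      using cong_count[OF that, of a] cw by (auto simp: count_list_0_iff)
    then show ?thesis using cong_sym_iff by metis
  qed
  also have "(\<exists>v. v @ w \<simeq> u) \<longleftrightarrow> trace_letters c \<subseteq> initials (rev u)"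
    using clique_suffix_iff[OF assms, of u] w by (simp add: trace_of_eq_iff)
  finally show ?thesis .
qed

text \<open>Expanding the product of the generating series of the \<open>a\<close>-free traces with the alternating
  sum of cliques, almost everything cancels: the cliques \<open>c\<close> with \<open>y = z c\<close> and \<open>z\<close> free of
  \<open>a\<close> are the sets of final letters of \<open>y\<close> that contain all the \<open>a\<close> of \<open>y\<close>.  Their signs
  add up to zero unless \<open>y\<close> is empty or \<open>y\<close> has a single \<open>a\<close> that is its only final letter.\<close>

lemma clique_factor_sum:
  assumes "y \<in> carrier M"
  shows "(\<Sum>c\<in>cliques I. (- 1) ^ trace_length c * of_bool (y \<in> (\<lambda>z. z \<otimes>\<^bsub>M\<^esub> c) ` avoiding a))
    = (of_bool (y = \<one>\<^bsub>M\<^esub>) - of_bool (y \<in> pyramids a) :: 'b::comm_ring_1)"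
    (is "?S = _")
proof -
  obtain u where u: "y = trace_of I u" using assms by (auto simp: carrier_eq)
  define L where "L = initials (rev u)"
  have L: "(b, c) \<in> I" if "b \<in> L" "c \<in> L" "b \<noteq> c" for b c
    using that initials_indep by (auto simp: L_def)
  have L_empty: "L = {} \<longleftrightarrow> u = []" by (simp add: L_def initials_empty_iff)
  have L_set: "L \<subseteq> set u" using initials_subset[of "rev u"] by (simp add: L_def)
  have one: "y = \<one>\<^bsub>M\<^esub> \<longleftrightarrow> u = []" by (simp add: u one_eq trace_of_eq_iff)
  have S: "?S = (\<Sum>c\<in>{c \<in> cliques I. trace_letters c \<subseteq> L \<and>
      count_list u a = of_bool (a \<in> trace_letters c)}. (- 1) ^ trace_length c)"
    unfolding u L_def
    by (intro sum.mono_neutral_cong_right) (auto simp: finite_cliques clique_factor_iff)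
  consider "count_list u a = 0" | "count_list u a = 1" | "count_list u a > 1" by linarith
  then show ?thesis
  proof cases
    case 1
    then have "a \<notin> L" using L_set by (auto simp: count_list_0_iff)
    then have "?S = (\<Sum>c\<in>{c \<in> cliques I. trace_letters c \<subseteq> L}. (- 1) ^ trace_length c)"
      unfolding S by (intro sum.cong) (auto simp: 1)
    also have "\<dots> = of_bool (u = [])" using clique_alternating_sum[of L, OF L] by (simp add: L_empty)
    finally show ?thesis using 1 one by (simp add: u pyramids_iff)
  next
    case 2
    \<comment> \<open>The clique must contain the only \<open>a\<close>, which is possible only if \<open>a\<close> is in \<open>L\<close>; otherwise
      the two sums below are equal.\<close>
    then have "L \<noteq> {}" using L_empty by auto
    have "?S = (\<Sum>c\<in>{c \<in> cliques I. trace_letters c \<subseteq> L} -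
        {c \<in> cliques I. trace_letters c \<subseteq> L - {a}}. (- 1) ^ trace_length c)"
      unfolding S by (intro sum.cong) (auto simp: 2)
    also have "\<dots> = (\<Sum>c\<in>{c \<in> cliques I. trace_letters c \<subseteq> L}. (- 1) ^ trace_length c)
        - (\<Sum>c\<in>{c \<in> cliques I. trace_letters c \<subseteq> L - {a}}. (- 1) ^ trace_length c)"
      by (intro sum_diff) (auto simp: finite_cliques)
    also have "\<dots> = of_bool (L = {}) - of_bool (L - {a} = {})"
      using clique_alternating_sum[of L, OF L, where 'b = 'b]
        clique_alternating_sum[of "L - {a}", where 'b = 'b] L by simp
    also have "\<dots> = of_bool (y = \<one>\<^bsub>M\<^esub>) - of_bool (y \<in> pyramids a)"
      using 2 \<open>L \<noteq> {}\<close> L_empty one by (auto simp: u pyramids_iff pyramid_iff L_def)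
    finally show ?thesis .
  next
    case 3
    then have none: "{c \<in> cliques I. trace_letters c \<subseteq> L \<and>
      count_list u a = of_bool (a \<in> trace_letters c)} = {}" by (auto split: if_splits)
    have "u \<noteq> []" using 3 by auto
    then show ?thesis using 3 one unfolding S none by (simp add: u pyramids_iff)
  qed
qed

lemma inj_on_mult_right: "c \<in> carrier M \<Longrightarrow> inj_on (\<lambda>z. z \<otimes>\<^bsub>M\<^esub> c) (carrier M)"
  by (auto simp: inj_on_def carrier_eq trace_of_eq_iff cong_append_cancel_right)

lemma avoiding_carrier: "avoiding a \<subseteq> carrier M"
  by (auto simp: avoiding_def)

lemma pyramids_carrier: "pyramids a \<subseteq> carrier M"
  by (auto simp: pyramids_def)

text \<open>If \<open>\<phi>\<close> is orthogonal to the alternating sum of cliques behind every \<open>a\<close>-free trace, the two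
  surviving terms of the expansion balance each other.  The sum over cliques is finite, so
  it may be exchanged with the infinite sum over traces.\<close>

lemma pyramidal_expansion:
  fixes \<phi> :: "'a trace \<Rightarrow> 'b::{real_normed_field, banach}"
  assumes summable: "\<And>c. c \<in> cliques I \<Longrightarrow> (\<lambda>z. \<phi> (z \<otimes>\<^bsub>M\<^esub> c)) summable_on avoiding a"
    and balanced: "\<And>z. z \<in> avoiding a \<Longrightarrow>
      (\<Sum>c\<in>cliques I. (- 1) ^ trace_length c * \<phi> (z \<otimes>\<^bsub>M\<^esub> c)) = 0"
  shows "(\<phi> has_sum \<phi> \<one>\<^bsub>M\<^esub>) (pyramids a)"
proof -
  define S where "S c = infsum (\<lambda>z. \<phi> (z \<otimes>\<^bsub>M\<^esub> c)) (avoiding a)" for c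
  let ?F = "\<lambda>c. (\<lambda>z. z \<otimes>\<^bsub>M\<^esub> c) ` avoiding a"
  let ?s = "\<lambda>c. (- 1) ^ trace_length c :: 'b"
  have hS: "((\<lambda>z. \<phi> (z \<otimes>\<^bsub>M\<^esub> c)) has_sum S c) (avoiding a)" if "c \<in> cliques I" for c
    using summable[OF that] by (simp add: S_def)
  have "((\<lambda>z. \<Sum>c\<in>cliques I. ?s c * \<phi> (z \<otimes>\<^bsub>M\<^esub> c)) has_sum (\<Sum>c\<in>cliques I. ?s c * S c)) (avoiding a)"
    by (intro has_sum_sum has_sum_cmult_right hS)
  moreover have "((\<lambda>z. \<Sum>c\<in>cliques I. ?s c * \<phi> (z \<otimes>\<^bsub>M\<^esub> c)) has_sum 0) (avoiding a)"
    using balanced by (intro has_sum_0)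
  ultimately have zero: "(\<Sum>c\<in>cliques I. ?s c * S c) = 0" by (rule has_sum_unique)
  have "((\<lambda>y. of_bool (y \<in> ?F c) * \<phi> y) has_sum S c) (carrier M)" if "c \<in> cliques I" for c
  proof -
    have "inj_on (\<lambda>z. z \<otimes>\<^bsub>M\<^esub> c) (avoiding a)"
      using inj_on_subset[OF inj_on_mult_right avoiding_carrier] cliques_carrier[OF that] by blast
    then have "(\<phi> has_sum S c) (?F c)"
      using hS[OF that] by (simp add: has_sum_reindex o_def)
    then show ?thesis
      by (rule has_sum_cong_neutral[THEN iffD1, rotated -1])
         (use avoiding_carrier cliques_carrier[OF that] in auto)
  qed
  then have "((\<lambda>y. \<Sum>c\<in>cliques I. ?s c * (of_bool (y \<in> ?F c) * \<phi> y))
      has_sum (\<Sum>c\<in>cliques I. ?s c * S c)) (carrier M)"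
    by (intro has_sum_sum has_sum_cmult_right)
  moreover have "(\<Sum>c\<in>cliques I. ?s c * (of_bool (y \<in> ?F c) * \<phi> y))
      = (of_bool (y = \<one>\<^bsub>M\<^esub>) - of_bool (y \<in> pyramids a)) * \<phi> y" if "y \<in> carrier M" for y
    by (subst clique_factor_sum[OF that, symmetric]) (simp add: sum_distrib_right mult.assoc)
  ultimately have "((\<lambda>y. (of_bool (y = \<one>\<^bsub>M\<^esub>) - of_bool (y \<in> pyramids a)) * \<phi> y)
      has_sum 0) (carrier M)"
    unfolding zero by (subst (asm) has_sum_cong) auto
  moreover have "((\<lambda>y. of_bool (y = \<one>\<^bsub>M\<^esub>) * \<phi> y) has_sum \<phi> \<one>\<^bsub>M\<^esub>) (carrier M)"
  proof (rule has_sum_cong_neutral[THEN iffD1])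
    show "(\<phi> has_sum \<phi> \<one>\<^bsub>M\<^esub>) {\<one>\<^bsub>M\<^esub>}" by (intro has_sum_finiteI) auto
  qed (auto simp: one_eq)
  ultimately have "((\<lambda>y. of_bool (y = \<one>\<^bsub>M\<^esub>) * \<phi> y + - ((of_bool (y = \<one>\<^bsub>M\<^esub>) - of_bool (y \<in> pyramids a)) * \<phi> y))
      has_sum (\<phi> \<one>\<^bsub>M\<^esub> + - 0)) (carrier M)"
    by (intro has_sum_add has_sum_uminusI)
  then have "((\<lambda>y. of_bool (y \<in> pyramids a) * \<phi> y) has_sum \<phi> \<one>\<^bsub>M\<^esub>) (carrier M)"
    by (simp add: algebra_simps)
  then show ?thesis
    by (rule has_sum_cong_neutral[THEN iffD1, rotated -1]) (use pyramids_carrier in auto)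
qed

end

section \<open>Words that seal off their past\<close>

locale irreducible_concurrent_system =
  fixes I :: "('a::finite \<times> 'a) set" and act :: "'s::finite option \<Rightarrow> 'a trace \<Rightarrow> 's option"
  assumes irreducible: "irreducible_system I act"

sublocale irreducible_concurrent_system \<subseteq> finite_independence I
  using irreducible
  by unfold_locales (auto simp: irreducible_system_def concurrent_system_def)

context irreducible_concurrent_system
begin

lemma act_mult: "x \<in> carrier M \<Longrightarrow> y \<in> carrier M \<Longrightarrow> act p (x \<otimes>\<^bsub>M\<^esub> y) = act (act p x) y"
  using irreducible unfolding irreducible_system_def concurrent_system_def by blast

lemma act_append: "act p (trace_of I (u @ v)) = act (act p (trace_of I u)) (trace_of I v)"
  using act_mult[of "trace_of I u" "trace_of I v"] by simp

lemma act_None [simp]: "x \<in> carrier M \<Longrightarrow> act None x = None"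
  using irreducible unfolding irreducible_system_def concurrent_system_def by blast

lemma act_one [simp]: "act p \<one>\<^bsub>M\<^esub> = p"
  using irreducible unfolding irreducible_system_def concurrent_system_def by blast

lemma reachable: "\<exists>u. act (Some \<alpha>) (trace_of I u) = Some \<beta>"
  using irreducible
  by (fastforce simp: irreducible_system_def transitive_system_def traces_between_def carrier_eq)

lemma enabled_eventually: "\<exists>u. act (Some \<alpha>) (trace_of I (u @ [a])) \<noteq> None"
proof -
  obtain x where "x \<in> carrier M" "act (Some \<alpha>) (x \<otimes>\<^bsub>M\<^esub> trace_of I [a]) \<noteq> None"
    using irreducible unfolding irreducible_system_def by blast
  moreover from this obtain u where "x = trace_of I u" by (auto simp: carrier_eq)
  ultimately have "act (Some \<alpha>) (trace_of I (u @ [a])) \<noteq> None" by simp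
  then show ?thesis by (rule exI)
qed

lemma dependence_path: "(b, a) \<in> (UNIV \<times> UNIV - I)\<^sup>*"
  using irreducible unfolding irreducible_system_def irreducible_trace_monoid_def by blast

text \<open>Every letter stays fireable in the future of every state, so the letters of a dependence
  path from \<open>b\<close> to \<open>a\<close> can be fired one after the other, whatever has to be fired in between.\<close>

lemma exists_word_below: "\<exists>w. act (Some \<beta>) (trace_of I w) \<noteq> None \<and> b \<in> below a {} w"
  using dependence_path[of b a]
proof (induction arbitrary: \<beta> rule: converse_rtrancl_induct)
  case base
  obtain u where u: "act (Some \<beta>) (trace_of I (u @ [a])) \<noteq> None"
    using enabled_eventually by blast
  have "a \<in> below a {} [a]" using irrefl_I by (auto simp: irrefl_def)
  then have "a \<in> below a {} (u @ [a])"
    unfolding below_append using below_increasing by blast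
  then show ?case using u by blast
next
  case (step b c)
  obtain u \<gamma> where u: "act (Some \<beta>) (trace_of I (u @ [c])) = Some \<gamma>"
    using enabled_eventually by blast
  obtain w where w: "act (Some \<gamma>) (trace_of I w) \<noteq> None" "c \<in> below a {} w"
    using step.IH by blast
  have "b \<in> below a {} (c # w)" using w step.hyps by auto
  then have "b \<in> below a {} (u @ c # w)"
    unfolding below_append using below_increasing by blast
  moreover have "act (Some \<beta>) (trace_of I (u @ c # w)) \<noteq> None"
    using act_append[of "Some \<beta>" "u @ [c]" w] u w by simp
  ultimately show ?case by blast
qed

lemma exists_word_below_all: "\<exists>w. act (Some \<beta>) (trace_of I w) \<noteq> None \<and> below a {} w = UNIV"
proof -
  have "\<exists>w. act (Some \<beta>) (trace_of I w) \<noteq> None \<and> B \<subseteq> below a {} w" if "finite B" for B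
    using that
  proof (induction B arbitrary: \<beta> rule: finite_induct)
    case empty
    have "act (Some \<beta>) (trace_of I []) \<noteq> None" using act_one by (simp add: one_eq)
    then show ?case by blast
  next
    case (insert b B)
    obtain u \<gamma> where u: "act (Some \<beta>) (trace_of I u) = Some \<gamma>" "b \<in> below a {} u"
      using exists_word_below by blast
    obtain w where w: "act (Some \<gamma>) (trace_of I w) \<noteq> None" "B \<subseteq> below a {} w"
      using insert.IH by blast
    have "insert b B \<subseteq> below a {} (u @ w)"
      using u w below_increasing[of "below a {} w" a u] below_mono[of "{}" "below a {} w" a u]
      by (auto simp: below_append)
    then show ?case using u w by (intro exI[of _ "u @ w"]) (simp add: act_append)
  qed
  from this[of UNIV] show ?thesis by auto
qed

text \<open>Every state enables a word in which each letter of the alphabet has a dependence path to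
  some \<open>a\<close>; a shortest one has no final letter other than \<open>a\<close>, since a different final letter
  could be dropped.\<close>

lemma sealing_word:
  "\<exists>w. act (Some \<beta>) (trace_of I w) \<noteq> None \<and> pyramid a w \<and> below a {} w = UNIV"
proof -
  define P where "P w \<longleftrightarrow> act (Some \<beta>) (trace_of I w) \<noteq> None \<and> below a {} w = UNIV" for w
  have "\<exists>w. P w" using exists_word_below_all by (simp add: P_def)
  then obtain w where w: "P w" and least: "\<And>v. P v \<Longrightarrow> length w \<le> length v"
    using ex_has_least_nat[of P _ length] by blast
  have "c = a" if c: "can_start c (rev w)" for c
  proof (rule ccontr)
    assume "c \<noteq> a"
    obtain v where v: "w \<simeq> v @ [c]" using can_end_iff[THEN iffD1, OF c] by (rule exE)
    have "act (Some \<beta>) (trace_of I w) = act (Some \<beta>) (trace_of I (v @ [c]))"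
      using trace_of_eq_iff v by metis
    then have "act (Some \<beta>) (trace_of I v) \<noteq> None"
      using w by (cases "act (Some \<beta>) (trace_of I v)") (auto simp: P_def act_append)
    moreover have "below a {} v = UNIV"
      using w below_cong[OF v, of a "{}"] \<open>c \<noteq> a\<close> by (simp add: P_def below_append)
    ultimately have "P v" by (simp add: P_def)
    then show False using least[of v] cong_length[OF v] by simp
  qed
  then show ?thesis using w unfolding P_def pyramid_def by blast
qed

end

section \<open>Cylinders of infinite traces\<close>

context finite_independence
begin

lemma inf_prefix_carrier: "\<omega> \<in> boundary I \<Longrightarrow> inf_prefix I \<omega> n \<in> carrier M"
  by (induction n) (auto simp: one_eq boundary_def cliques_carrier)

lemma inf_prefix_le:
  assumes "\<omega> \<in> boundary I" "inf_prefix I \<omega> n = trace_of I u" "n \<le> k"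
  shows "\<exists>v. inf_prefix I \<omega> k = trace_of I (u @ v)"
  using assms(3)
proof (induction rule: dec_induct)
  case base show ?case using assms(2) by (metis append_Nil2)
next
  case (step k)
  then obtain v where v: "inf_prefix I \<omega> k = trace_of I (u @ v)" by blast
  have "\<omega> k \<in> carrier M" using assms(1) by (auto simp: boundary_def cliques_carrier)
  then obtain w where "\<omega> k = trace_of I w" by (auto simp: carrier_eq)
  then show ?case using v by (intro exI[of _ "v @ w"]) simp
qed

lemma inf_trace_le_common:
  assumes "\<omega> \<in> boundary I" "inf_trace_le I (trace_of I u) \<omega>" "inf_trace_le I (trace_of I v) \<omega>"
  shows "\<exists>r s. u @ r \<simeq> v @ s"
proof -
  obtain i j where ij: "trace_le I (trace_of I u) (inf_prefix I \<omega> i)"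
    "trace_le I (trace_of I v) (inf_prefix I \<omega> j)"
    using assms(2,3) by (auto simp: inf_trace_le_def)
  then obtain r s where rs: "inf_prefix I \<omega> i = trace_of I (u @ r)"
    "inf_prefix I \<omega> j = trace_of I (v @ s)"
    by (auto simp: trace_le_def carrier_eq)
  obtain r' s' where "inf_prefix I \<omega> (max i j) = trace_of I ((u @ r) @ r')"
    "inf_prefix I \<omega> (max i j) = trace_of I ((v @ s) @ s')"
    using inf_prefix_le[OF assms(1) rs(1), of "max i j"]
      inf_prefix_le[OF assms(1) rs(2), of "max i j"] by auto
  then have "(u @ r) @ r' \<simeq> (v @ s) @ s'" using trace_of_eq_iff by metis
  then have "u @ (r @ r') \<simeq> v @ (s @ s')" by simp
  then show ?thesis by blast
qed

definition inf_initials :: "'a inf_trace \<Rightarrow> 'a set" where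
  "inf_initials \<omega> = {b. inf_trace_le I (trace_of I [b]) \<omega>}"

lemma initials_mono: "initials u \<subseteq> initials (u @ v)"
  by (auto simp: initials_def can_start_append)

lemma letter_le_iff: "trace_le I (trace_of I [b]) (trace_of I u) \<longleftrightarrow> b \<in> initials u"
  by (simp add: trace_le_of initials_def can_start_iff)

text \<open>The alphabet is finite, so all initial letters show up in one finite prefix.\<close>

lemma inf_initials_prefix:
  assumes "\<omega> \<in> boundary I"
  shows "\<exists>n u. inf_prefix I \<omega> n = trace_of I u \<and> inf_initials \<omega> = initials u"
proof -
  have "\<forall>b\<in>inf_initials \<omega>. \<exists>n. trace_le I (trace_of I [b]) (inf_prefix I \<omega> n)"
    by (auto simp: inf_initials_def inf_trace_le_def)
  then obtain n where n: "\<And>b. b \<in> inf_initials \<omega> \<Longrightarrow>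
      trace_le I (trace_of I [b]) (inf_prefix I \<omega> (n b))" by metis
  define N where "N = Max (n ` UNIV)"
  obtain u where u: "inf_prefix I \<omega> N = trace_of I u"
    using inf_prefix_carrier[OF assms] by (auto simp: carrier_eq)
  have "b \<in> initials u" if "b \<in> inf_initials \<omega>" for b
  proof -
    have "n b \<le> N" by (simp add: N_def)
    obtain v where v: "inf_prefix I \<omega> (n b) = trace_of I v"
      using inf_prefix_carrier[OF assms] by (auto simp: carrier_eq)
    obtain v' where "inf_prefix I \<omega> N = trace_of I (v @ v')"
      using inf_prefix_le[OF assms v \<open>n b \<le> N\<close>] by blast
    moreover have "trace_le I (trace_of I [b]) (trace_of I (v @ v'))"
      using n[OF that] v initials_mono by (auto simp: letter_le_iff)
    ultimately show ?thesis using u letter_le_iff by metis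
  qed
  moreover have "initials u \<subseteq> inf_initials \<omega>"
    using u by (auto simp: inf_initials_def inf_trace_le_def letter_le_iff[symmetric] intro!: exI[of _ N])
  ultimately show ?thesis using u by blast
qed

lemma inf_initials_nonempty:
  assumes "\<omega> \<in> boundary I"
  shows "inf_initials \<omega> \<noteq> {}"
proof -
  have c: "\<omega> 0 \<in> cliques I" "\<omega> 0 \<noteq> \<one>\<^bsub>M\<^esub>" using assms by (auto simp: boundary_def)
  then obtain w where w: "\<omega> 0 = trace_of I w" by (auto simp: cliques_eq)
  have "inf_prefix I \<omega> 1 = trace_of I w" by (simp add: one_eq w)
  moreover have "w \<noteq> []" using c w by (auto simp: one_eq)
  then obtain b where "b \<in> initials w" using initials_empty_iff by blast
  ultimately have "b \<in> inf_initials \<omega>"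
    unfolding inf_initials_def inf_trace_le_def mem_Collect_eq
    by (intro exI[of _ 1]) (simp add: letter_le_iff)
  then show ?thesis by blast
qed

lemma inf_clique_le_iff:
  assumes "\<omega> \<in> boundary I" "c \<in> cliques I"
  shows "inf_trace_le I c \<omega> \<longleftrightarrow> trace_letters c \<subseteq> inf_initials \<omega>"
proof
  assume "inf_trace_le I c \<omega>"
  then obtain n where n: "trace_le I c (inf_prefix I \<omega> n)" by (auto simp: inf_trace_le_def)
  obtain u where u: "inf_prefix I \<omega> n = trace_of I u"
    using inf_prefix_carrier[OF assms(1)] by (auto simp: carrier_eq)
  have "trace_letters c \<subseteq> initials u" using n u clique_le_iff[OF assms(2)] by simp
  moreover have "initials u \<subseteq> inf_initials \<omega>"
    using u by (auto simp: inf_initials_def inf_trace_le_def letter_le_iff[symmetric] intro!: exI[of _ n])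
  ultimately show "trace_letters c \<subseteq> inf_initials \<omega>" by blast
next
  assume le: "trace_letters c \<subseteq> inf_initials \<omega>"
  obtain n u where "inf_prefix I \<omega> n = trace_of I u" "inf_initials \<omega> = initials u"
    using inf_initials_prefix[OF assms(1)] by blast
  then show "inf_trace_le I c \<omega>"
    using le clique_le_iff[OF assms(2)] unfolding inf_trace_le_def by metis
qed

text \<open>The cliques below an infinite trace are the subsets of its set of initial letters, which is
  not empty; so they are equally often even and odd.\<close>

lemma inf_clique_alternating_sum:
  assumes "\<omega> \<in> boundary I"
  shows "(\<Sum>c\<in>{c \<in> cliques I. inf_trace_le I c \<omega>}. (- 1) ^ trace_length c) = (0::'b::comm_ring_1)"
proof -
  obtain n u where u: "inf_initials \<omega> = initials u" using inf_initials_prefix[OF assms] by blast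
  have "{c \<in> cliques I. inf_trace_le I c \<omega>} = {c \<in> cliques I. trace_letters c \<subseteq> initials u}"
    using inf_clique_le_iff[OF assms] u by auto
  then show ?thesis
    using clique_alternating_sum[of "initials u", where 'b = 'b] initials_indep
      inf_initials_nonempty[OF assms] u by auto
qed

end

section \<open>Markov measures\<close>

locale markov_system = irreducible_concurrent_system I act
  for I :: "('a::finite \<times> 'a) set" and act :: "'s::finite option \<Rightarrow> 'a trace \<Rightarrow> 's option" +
  fixes m :: "'s \<Rightarrow> 'a inf_trace measure"
  assumes markov: "markov_measure I act m"
begin

definition weight :: "'s \<Rightarrow> 'a trace \<Rightarrow> real" where
  "weight \<alpha> x = measure (m \<alpha>) (cylinder I x)"

lemma prob_space_m: "prob_space (m \<alpha>)"
  using markov by (simp add: markov_measure_def)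

lemma boundary_from_full: "measure (m \<alpha>) (boundary_from I act \<alpha>) = 1"
  using markov by (simp add: markov_measure_def)

lemma weight_nonneg [simp]: "0 \<le> weight \<alpha> x"
  by (simp add: weight_def)

lemma weight_le_1 [simp]: "weight \<alpha> x \<le> 1"
  unfolding weight_def by (rule prob_space.prob_le_1[OF prob_space_m])

lemma weight_pos_iff: "x \<in> carrier M \<Longrightarrow> 0 < weight \<alpha> x \<longleftrightarrow> act (Some \<alpha>) x \<noteq> None"
  using markov by (auto simp: markov_measure_def weight_def traces_from_def)

lemma weight_eq_0: "x \<in> carrier M \<Longrightarrow> act (Some \<alpha>) x = None \<Longrightarrow> weight \<alpha> x = 0"
  using weight_pos_iff[of x \<alpha>] weight_nonneg[of \<alpha> x] by linarith

lemma weight_mult: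
  "x \<in> carrier M \<Longrightarrow> y \<in> carrier M \<Longrightarrow> act (Some \<alpha>) x = Some \<beta> \<Longrightarrow>
    weight \<alpha> (x \<otimes>\<^bsub>M\<^esub> y) = weight \<alpha> x * weight \<beta> y"
  using markov by (simp add: markov_measure_def weight_def)

lemma weight_one [simp]: "weight \<alpha> \<one>\<^bsub>M\<^esub> = 1"
proof -
  have "\<one>\<^bsub>M\<^esub> \<otimes>\<^bsub>M\<^esub> \<one>\<^bsub>M\<^esub> = \<one>\<^bsub>M\<^esub>" by (simp add: one_eq)
  then have "weight \<alpha> \<one>\<^bsub>M\<^esub> = weight \<alpha> \<one>\<^bsub>M\<^esub> * weight \<alpha> \<one>\<^bsub>M\<^esub>"
    using weight_mult[of "\<one>\<^bsub>M\<^esub>" "\<one>\<^bsub>M\<^esub>" \<alpha> \<alpha>] by (simp add: one_eq) (simp flip: one_eq)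
  moreover have "0 < weight \<alpha> \<one>\<^bsub>M\<^esub>"
    using weight_pos_iff[of "\<one>\<^bsub>M\<^esub>" \<alpha>] by (simp add: one_eq) (simp flip: one_eq)
  ultimately show ?thesis by simp
qed

text \<open>A cylinder with positive weight is measurable, because the measure of a
  non-measurable set is 0.\<close>

lemma cylinder_sets: "x \<in> carrier M \<Longrightarrow> act (Some \<alpha>) x \<noteq> None \<Longrightarrow> cylinder I x \<in> sets (m \<alpha>)"
  using weight_pos_iff[of x \<alpha>] measure_notin_sets by (fastforce simp: weight_def)

text \<open>By inclusion-exclusion this sum is the probability that an infinite trace has no initial
  letter.\<close>

lemma moebius_weight: "(\<Sum>c\<in>cliques I. (- 1) ^ trace_length c * weight \<alpha> c) = 0"
proof -
  interpret prob_space "m \<alpha>" by (rule prob_space_m)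
  define B where "B = boundary_from I act \<alpha>"
  define E where "E c = {\<omega> \<in> B. inf_trace_le I c \<omega>}" for c
  have B1: "measure (m \<alpha>) B = 1" using boundary_from_full by (simp add: B_def)
  then have B_sets: "B \<in> sets (m \<alpha>)" by (metis measure_notin_sets zero_neq_one)
  have BAE: "AE \<omega> in m \<alpha>. \<omega> \<in> B" using B1 by (rule AE_prob_1)
  have B_boundary: "\<omega> \<in> boundary I" if "\<omega> \<in> B" for \<omega>
    using that by (simp add: B_def boundary_from_def)
  \<comment> \<open>Restricting to \<open>B\<close> makes the cylinders of the forbidden cliques empty and hence
    measurable.\<close>
  have E: "E c \<in> sets (m \<alpha>) \<and> measure (m \<alpha>) (E c) = weight \<alpha> c" if "c \<in> cliques I" for c
  proof (cases "act (Some \<alpha>) c = None")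
    case True
    then have "E c = {}" using cliques_carrier[OF that]
      by (auto simp: E_def B_def boundary_from_def traces_from_def)
    then show ?thesis using weight_eq_0[OF cliques_carrier[OF that] True] by simp
  next
    case False
    have E_eq: "E c = cylinder I c \<inter> B" using B_boundary by (auto simp: E_def cylinder_def)
    have cyl: "cylinder I c \<in> sets (m \<alpha>)" using cylinder_sets[OF cliques_carrier[OF that] False] .
    have "measure (m \<alpha>) (E c) = measure (m \<alpha>) (cylinder I c)"
      unfolding E_eq
      by (rule finite_measure_eq_AE) (use BAE cyl B_sets in auto)
    then show ?thesis using cyl B_sets by (simp add: E_eq weight_def)
  qed
  have "(\<Sum>c\<in>cliques I. (- 1) ^ trace_length c * weight \<alpha> c)
      = (\<Sum>c\<in>cliques I. \<integral>\<omega>. (- 1) ^ trace_length c * indicat_real (E c) \<omega> \<partial>m \<alpha>)"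
    using E by (intro sum.cong) auto
  also have "\<dots> = (\<integral>\<omega>. (\<Sum>c\<in>cliques I. (- 1) ^ trace_length c * indicat_real (E c) \<omega>) \<partial>m \<alpha>)"
    using E by (intro Bochner_Integration.integral_sum[symmetric]) 
       (auto intro!: integrable_mult_right integrable_real_indicator simp: less_top[symmetric])
  also have "\<dots> = (\<integral>\<omega>. 0 \<partial>m \<alpha>)"
  proof (rule Bochner_Integration.integral_cong)
    fix \<omega> assume "\<omega> \<in> space (m \<alpha>)"
    show "(\<Sum>c\<in>cliques I. (- 1) ^ trace_length c * indicat_real (E c) \<omega>) = 0"
    proof (cases "\<omega> \<in> B")
      case True
      have "(\<Sum>c\<in>cliques I. (- 1) ^ trace_length c * indicat_real (E c) \<omega>)
          = (\<Sum>c\<in>{c \<in> cliques I. inf_trace_le I c \<omega>}. (- 1) ^ trace_length c)"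
        using True by (intro sum.mono_neutral_cong_right) (auto simp: finite_cliques E_def)
      then show ?thesis using inf_clique_alternating_sum[OF B_boundary[OF True]] by simp
    qed (simp add: E_def)
  qed simp
  finally show ?thesis by simp
qed

text \<open>Append to each \<open>a\<close>-free trace \<open>z\<close> the sealing word \<open>w\<close> of the state it leads to.  The
  result is the past of the last \<open>a\<close> of \<open>w\<close>, whose rank among all occurrences of \<open>a\<close> depends on
  the state only.  So an infinite trace lies above at most one \<open>z w\<close> per state, and the total
  weight of the \<open>z\<close> that lead to \<open>\<beta>\<close> is at most the inverse of the weight of \<open>w\<close> at \<open>\<beta>\<close>.\<close>

lemma summable_avoiding: "weight \<alpha> summable_on avoiding a"
proof -
  interpret prob_space "m \<alpha>" by (rule prob_space_m)
  obtain w where w: "\<And>\<beta>. act (Some \<beta>) (trace_of I (w \<beta>)) \<noteq> None"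
    and seal: "\<And>\<beta>. pyramid a (w \<beta>)" "\<And>\<beta>. below a {} (w \<beta>) = UNIV"
    using sealing_word[of _ a] by metis
  define s where "s \<beta> = trace_of I (w \<beta>)" for \<beta>
  have s: "s \<beta> \<in> carrier M" "0 < weight \<beta> (s \<beta>)" for \<beta>
    using w weight_pos_iff[of "s \<beta>" \<beta>] by (auto simp: s_def)
  have bound: "sum (weight \<alpha>) Z \<le> (\<Sum>\<beta>\<in>UNIV. 1 / weight \<beta> (s \<beta>))"
    if Z: "finite Z" "Z \<subseteq> avoiding a" for Z
  proof -
    define Y where "Y \<beta> = {z \<in> Z. act (Some \<alpha>) z = Some \<beta>}" for \<beta>
    have Z_carrier: "z \<in> carrier M" if "z \<in> Z" for z using that Z avoiding_carrier by blast
    have part: "sum (weight \<alpha>) (Y \<beta>) \<le> 1 / weight \<beta> (s \<beta>)" for \<beta>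
    proof -
      let ?C = "\<lambda>z. cylinder I (z \<otimes>\<^bsub>M\<^esub> s \<beta>)"
      have weight_C: "measure (m \<alpha>) (?C z) = weight \<alpha> z * weight \<beta> (s \<beta>)" if "z \<in> Y \<beta>" for z
        using that weight_mult[OF Z_carrier s(1)] by (simp add: Y_def weight_def)
      have "act (Some \<alpha>) (z \<otimes>\<^bsub>M\<^esub> s \<beta>) \<noteq> None" if "z \<in> Y \<beta>" for z
        using that w[of \<beta>] act_mult[OF Z_carrier s(1)] by (simp add: Y_def s_def)
      then have C_sets: "?C ` Y \<beta> \<subseteq> sets (m \<alpha>)"
        using cylinder_sets[OF mult_carrier[OF Z_carrier s(1)]] by (auto simp: Y_def)
      have "disjoint_family_on ?C (Y \<beta>)"
      unfolding disjoint_family_on_def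
      proof (intro ballI impI, rule ccontr)
        fix z z' assume z: "z \<in> Y \<beta>" "z' \<in> Y \<beta>" "z \<noteq> z'" "?C z \<inter> ?C z' \<noteq> {}"
        then have "z \<in> avoiding a" "z' \<in> avoiding a" using Z by (auto simp: Y_def)
        then obtain u u' where u: "z = trace_of I u" "a \<notin> set u" "z' = trace_of I u'" "a \<notin> set u'"
          by (auto simp: avoiding_def)
        obtain \<omega> where "\<omega> \<in> boundary I" "inf_trace_le I (trace_of I (u @ w \<beta>)) \<omega>"
          "inf_trace_le I (trace_of I (u' @ w \<beta>)) \<omega>"
          using z(4) by (auto simp: cylinder_def u s_def)
        then obtain r r' where r: "(u @ w \<beta>) @ r \<simeq> (u' @ w \<beta>) @ r'"
          using inf_trace_le_common by blast
        have "u @ w \<beta> \<simeq> u' @ w \<beta>"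
        proof (rule pyramid_unique[OF _ _ r])
          show "pyramid a (u @ w \<beta>)" "pyramid a (u' @ w \<beta>)" by (intro pyramid_append seal)+
          show "count_list (u @ w \<beta>) a = count_list (u' @ w \<beta>) a"
            using u count_list_0_iff[of u a] count_list_0_iff[of u' a] by simp
        qed
        then show False using z(3) u by (simp add: trace_of_eq_iff cong_append_cancel_right)
      qed
      then have "measure (m \<alpha>) (\<Union>z\<in>Y \<beta>. ?C z) = (\<Sum>z\<in>Y \<beta>. measure (m \<alpha>) (?C z))"
        using C_sets Z by (intro finite_measure_finite_Union) (auto simp: Y_def)
      then have "sum (weight \<alpha>) (Y \<beta>) * weight \<beta> (s \<beta>) \<le> 1"
        using weight_C prob_le_1[of "\<Union>z\<in>Y \<beta>. ?C z"] by (simp add: sum_distrib_right)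
      then show ?thesis using s(2)[of \<beta>] by (simp add: field_simps)
    qed
    have "sum (weight \<alpha>) Z = (\<Sum>z\<in>Z. \<Sum>\<beta>\<in>UNIV. if act (Some \<alpha>) z = Some \<beta> then weight \<alpha> z else 0)"
    proof (rule sum.cong)
      fix z assume "z \<in> Z"
      show "weight \<alpha> z = (\<Sum>\<beta>\<in>UNIV. if act (Some \<alpha>) z = Some \<beta> then weight \<alpha> z else 0)"
        using weight_eq_0[OF Z_carrier[OF \<open>z \<in> Z\<close>]]
        by (cases "act (Some \<alpha>) z") auto
    qed simp
    also have "\<dots> = (\<Sum>\<beta>\<in>UNIV. sum (weight \<alpha>) (Y \<beta>))"
      by (subst sum.swap) (simp add: Y_def sum.inter_filter Z)
    also have "\<dots> \<le> (\<Sum>\<beta>\<in>UNIV. 1 / weight \<beta> (s \<beta>))" by (intro sum_mono part)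
    finally show ?thesis .
  qed
  show ?thesis
    by (rule nonneg_bdd_above_summable_on) (auto intro!: bdd_aboveI2 bound)
qed

section \<open>Vectors in the kernel of the Moebius matrix\<close>

text \<open>A prefix acts on this extension of \<open>v\<close> by a scalar factor (\<open>lift_mult\<close>), so a linear relation
  over the cliques that holds at all states also holds behind any trace.\<close>

definition lift :: "'b::real_normed_field \<Rightarrow> ('s \<Rightarrow> 'b) \<Rightarrow> 's \<Rightarrow> 'a trace \<Rightarrow> 'b" where
  "lift t v \<alpha> x = (case act (Some \<alpha>) x of None \<Rightarrow> 0
    | Some \<beta> \<Rightarrow> of_real (weight \<alpha> x) * t ^ trace_length x * v \<beta>)"

lemma trace_length_mult:
  "x \<in> carrier M \<Longrightarrow> y \<in> carrier M \<Longrightarrow> trace_length (x \<otimes>\<^bsub>M\<^esub> y) = trace_length x + trace_length y"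
  by (auto simp: carrier_eq)

lemma lift_mult:
  assumes "x \<in> carrier M" "y \<in> carrier M"
  shows "lift t v \<alpha> (x \<otimes>\<^bsub>M\<^esub> y) = (case act (Some \<alpha>) x of None \<Rightarrow> 0
    | Some \<beta> \<Rightarrow> of_real (weight \<alpha> x) * t ^ trace_length x * lift t v \<beta> y)"
  using assms
  by (auto simp: lift_def act_mult weight_mult trace_length_mult power_add split: option.split)

lemma lift_one: "lift t v \<alpha> \<one>\<^bsub>M\<^esub> = v \<alpha>"
  by (simp add: lift_def) (simp add: one_eq)

lemma norm_lift_le:
  assumes "norm t \<le> 1" "x \<in> carrier M" "\<And>\<beta>. norm (v \<beta>) \<le> K"
  shows "norm (lift t v \<alpha> x) \<le> weight \<alpha> x * norm t ^ trace_length x * K"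
proof (cases "act (Some \<alpha>) x")
  case None
  then show ?thesis using weight_eq_0[OF assms(2)] by (simp add: lift_def)
next
  case (Some \<beta>)
  then show ?thesis using assms(3)[of \<beta>]
    by (simp add: lift_def norm_mult norm_power mult_left_mono)
qed

text \<open>The sum over cliques \<open>c\<close>, grouped by the state \<open>\<alpha> \<cdot> c\<close>, is row \<open>\<alpha>\<close> of the product of the
  Moebius matrix of the weights at \<open>t\<close> with \<open>v\<close>.\<close>

definition in_kernel :: "'b::real_normed_field \<Rightarrow> ('s \<Rightarrow> 'b) \<Rightarrow> bool" where
  "in_kernel t v \<longleftrightarrow> (\<forall>\<alpha>. (\<Sum>c\<in>cliques I. (- 1) ^ trace_length c * lift t v \<alpha> c) = 0)"

text \<open>The pyramidal expansion turns the signed relation between a kernel vector and the cliques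
  into a relation with nonnegative coefficients, to which maximum arguments apply.\<close>

lemma kernel_has_sum:
  fixes t :: "'b::{real_normed_field, banach}"
  assumes t: "norm t \<le> 1" and kernel: "in_kernel t v"
  shows "(lift t v \<alpha> has_sum v \<alpha>) (pyramids a)"
proof -
  define K where "K = (\<Sum>\<beta>\<in>UNIV. norm (v \<beta>))"
  have K: "norm (v \<beta>) \<le> K" for \<beta> unfolding K_def by (rule member_le_sum) auto
  then have K0: "0 \<le> K" using norm_ge_zero order_trans by blast
  have "(lift t v \<alpha> has_sum lift t v \<alpha> \<one>\<^bsub>M\<^esub>) (pyramids a)"
  proof (rule pyramidal_expansion)
    fix c assume c: "c \<in> cliques I"
    have "norm (lift t v \<alpha> (z \<otimes>\<^bsub>M\<^esub> c)) \<le> K * weight \<alpha> z" if z: "z \<in> avoiding a" for z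
    proof -
      have zc: "z \<in> carrier M" "c \<in> carrier M" using z avoiding_carrier c cliques_carrier by auto
      have le: "weight \<alpha> (z \<otimes>\<^bsub>M\<^esub> c) \<le> weight \<alpha> z"
      proof (cases "act (Some \<alpha>) z")
        case None
        then have "act (Some \<alpha>) (z \<otimes>\<^bsub>M\<^esub> c) = None" using zc by (simp add: act_mult)
        then show ?thesis using weight_eq_0[OF mult_carrier[OF zc]] by simp
      next
        case (Some \<beta>)
        then show ?thesis using zc weight_mult[OF zc Some] mult_left_mono[OF weight_le_1[of \<beta> c] weight_nonneg[of \<alpha> z]]
          by simp
      qed
      have "norm (lift t v \<alpha> (z \<otimes>\<^bsub>M\<^esub> c)) \<le>
          weight \<alpha> (z \<otimes>\<^bsub>M\<^esub> c) * norm t ^ trace_length (z \<otimes>\<^bsub>M\<^esub> c) * K"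
        by (rule norm_lift_le[OF t mult_carrier[OF zc] K])
      also have "\<dots> \<le> weight \<alpha> z * 1 * K"
        by (intro mult_right_mono mult_mono le K0 power_le_one t) auto
      finally show ?thesis by (simp add: mult.commute)
    qed
    moreover have "(\<lambda>z. K * weight \<alpha> z) summable_on avoiding a"
      by (intro summable_on_cmult_right summable_avoiding)
    ultimately have "(\<lambda>z. norm (lift t v \<alpha> (z \<otimes>\<^bsub>M\<^esub> c))) summable_on avoiding a"
      by (rule_tac summable_on_comparison_test) auto
    then show "(\<lambda>z. lift t v \<alpha> (z \<otimes>\<^bsub>M\<^esub> c)) summable_on avoiding a"
      by (rule abs_summable_summable)
  next
    fix z assume "z \<in> avoiding a"
    then have z: "z \<in> carrier M" using avoiding_carrier by blast
    show "(\<Sum>c\<in>cliques I. (- 1) ^ trace_length c * lift t v \<alpha> (z \<otimes>\<^bsub>M\<^esub> c)) = 0"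
    proof (cases "act (Some \<alpha>) z")
      case None
      then show ?thesis using z by (intro sum.neutral) (auto simp: lift_mult cliques_carrier)
    next
      case (Some \<beta>)
      have "(\<Sum>c\<in>cliques I. (- 1) ^ trace_length c * lift t v \<alpha> (z \<otimes>\<^bsub>M\<^esub> c))
          = of_real (weight \<alpha> z) * t ^ trace_length z *
            (\<Sum>c\<in>cliques I. (- 1) ^ trace_length c * lift t v \<beta> c)"
        unfolding sum_distrib_left
        by (intro sum.cong) (auto simp: lift_mult z cliques_carrier Some)
      then show ?thesis using kernel by (simp add: in_kernel_def)
    qed
  qed
  then show ?thesis by (simp add: lift_one)
qed

lemma in_kernel_const: "in_kernel (1::real) (\<lambda>_. k)"
proof -
  have "lift 1 (\<lambda>_. k) \<alpha> c = weight \<alpha> c * k" if "c \<in> cliques I" for \<alpha> c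
    using weight_eq_0[OF cliques_carrier[OF that]] by (auto simp: lift_def split: option.split)
  then have "(\<Sum>c\<in>cliques I. (- 1) ^ trace_length c * lift 1 (\<lambda>_. k) \<alpha> c)
      = (\<Sum>c\<in>cliques I. (- 1) ^ trace_length c * weight \<alpha> c) * k" for \<alpha>
    by (simp add: sum_distrib_right mult.assoc)
  then show ?thesis by (simp add: in_kernel_def moebius_weight)
qed

lemma pyramids_total_weight: "(weight \<alpha> has_sum 1) (pyramids a)"
proof -
  have "(lift (1::real) (\<lambda>_. 1) \<alpha> has_sum 1) (pyramids a)"
    by (rule kernel_has_sum[OF _ in_kernel_const]) simp
  moreover have "lift (1::real) (\<lambda>_. 1) \<alpha> x = weight \<alpha> x" if "x \<in> pyramids a" for x
    using that pyramids_carrier weight_eq_0[of x \<alpha>] by (auto simp: lift_def split: option.split)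
  ultimately show ?thesis by (simp cong: has_sum_cong)
qed

lemma letter_pyramid: "trace_of I [a] \<in> pyramids a"
  by (simp add: pyramids_iff pyramid_def can_start_Cons can_start_def)

text \<open>At a state where \<open>v\<close> is maximal, the averages force \<open>v\<close> to be maximal at all states that a
  single letter leads to, and these generate the whole system.\<close>

lemma kernel_constant:
  fixes v :: "'s \<Rightarrow> real"
  assumes "in_kernel 1 v"
  shows "v \<alpha> = v \<beta>"
proof -
  define K where "K = Max (range v)"
  have K: "v \<gamma> \<le> K" for \<gamma> by (simp add: K_def)
  have step: "v \<gamma> = K" if \<beta>: "v \<beta> = K" and act: "act (Some \<beta>) (trace_of I [a]) = Some \<gamma>" for \<beta> \<gamma> a
  proof -
    have "((\<lambda>x. weight \<beta> x * K + - lift 1 v \<beta> x) has_sum (1 * K + - v \<beta>)) (pyramids a)"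
      using kernel_has_sum[OF _ assms] 
      by (intro has_sum_add has_sum_uminusI has_sum_cmult_left pyramids_total_weight) simp
    then have "weight \<beta> (trace_of I [a]) * K + - lift 1 v \<beta> (trace_of I [a]) = 0"
    proof (rule nonneg_has_sum_le_0D)
      fix x assume "x \<in> pyramids a"
      then have "x \<in> carrier M" using pyramids_carrier by blast
      then show "0 \<le> weight \<beta> x * K + - lift 1 v \<beta> x"
        using weight_eq_0[of x \<beta>] K weight_nonneg[of \<beta> x]
        by (auto simp: lift_def intro: mult_left_mono split: option.split)
    qed (use \<beta> letter_pyramid in auto)
    moreover have "0 < weight \<beta> (trace_of I [a])" using act by (simp add: weight_pos_iff)
    ultimately show ?thesis by (simp add: lift_def act)
  qed
  have path: "v \<gamma> = K" if "v \<beta> = K" "act (Some \<beta>) (trace_of I u) = Some \<gamma>" for \<beta> \<gamma> u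
    using that
  proof (induction u arbitrary: \<beta>)
    case Nil
    then show ?case using act_one by (simp flip: one_eq)
  next
    case (Cons a u)
    have "act (act (Some \<beta>) (trace_of I [a])) (trace_of I u) = Some \<gamma>"
      using Cons.prems(2) act_append[of "Some \<beta>" "[a]" u] by simp
    then show ?case using Cons.IH step[OF Cons.prems(1)]
      by (cases "act (Some \<beta>) (trace_of I [a])") auto
  qed
  have "K \<in> range v" unfolding K_def by (rule Max_in) auto
  then obtain \<delta> where "v \<delta> = K" by auto
  then show ?thesis using path reachable by metis
qed

text \<open>A pyramid has at least one letter, so each of its terms carries a factor \<open>t\<close>.\<close>

lemma kernel_zero:
  fixes t :: "'b::{real_normed_field, banach}"
  assumes t: "norm t < 1" and kernel: "in_kernel t v"
  shows "v \<alpha> = 0"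
proof -
  define K where "K = Max (range (\<lambda>\<beta>. norm (v \<beta>)))"
  have K: "norm (v \<beta>) \<le> K" for \<beta> by (simp add: K_def)
  then have K0: "0 \<le> K" using norm_ge_zero order_trans by blast
  have "K \<in> range (\<lambda>\<beta>. norm (v \<beta>))" unfolding K_def by (rule Max_in) auto
  then obtain \<beta> where \<beta>: "norm (v \<beta>) = K" by auto
  fix a :: 'a
  have "norm (v \<beta>) \<le> 1 * (norm t * K)"
  proof (rule norm_infsum_le)
    show "(lift t v \<beta> has_sum v \<beta>) (pyramids a)" using t kernel by (intro kernel_has_sum) auto
    show "((\<lambda>x. weight \<beta> x * (norm t * K)) has_sum 1 * (norm t * K)) (pyramids a)"
      by (intro has_sum_cmult_left pyramids_total_weight)
    fix x assume "x \<in> pyramids a"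
    then obtain u where u: "x = trace_of I u" "count_list u a = 1" by (auto simp: pyramids_def)
    then have "u \<noteq> []" by auto
    have "norm (lift t v \<beta> x) \<le> weight \<beta> x * norm t ^ trace_length x * K"
      using u t by (intro norm_lift_le K) auto
    also have "\<dots> \<le> weight \<beta> x * norm t ^ 1 * K"
      using t K0 \<open>u \<noteq> []\<close>
      by (intro mult_right_mono mult_left_mono power_decreasing) (auto simp: u Suc_le_eq)
    finally show "norm (lift t v \<beta> x) \<le> weight \<beta> x * (norm t * K)" by (simp add: mult.assoc)
  qed
  then have "K \<le> norm t * K" using \<beta> by simp
  then have "K = 0" using t K0 by (metis mult_le_cancel_right1 not_less order_antisym)
  then show ?thesis using K[of \<alpha>] by simp
qed

end

section \<open>Determinant and kernel of the Moebius matrix\<close>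

context markov_system
begin

text \<open>Up to the diagonal change of basis by \<open>u\<close>, the matrix at \<open>\<rho> t\<close> is the matrix of the
  weights at \<open>t\<close>.\<close>

lemma moebius_row:
  fixes t :: "'b::real_normed_field"
  assumes weight: "\<And>\<alpha> x. x \<in> carrier M \<Longrightarrow> weight \<alpha> x = twisted act \<rho> \<Delta> f \<alpha> x"
    and \<Delta>: "\<And>\<alpha> \<beta>. \<Delta> \<alpha> \<beta> = u \<beta> / u \<alpha>" and u: "\<And>\<alpha>. 0 < u \<alpha>"
  shows "(\<Sum>\<beta>\<in>UNIV. (\<Sum>c\<in>cliques_between I act \<alpha> \<beta>.
        of_real ((- 1) ^ trace_length c * f \<alpha> c) * (of_real \<rho> * t) ^ trace_length c) * v \<beta>)
    = of_real (u \<alpha>) *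
      (\<Sum>c\<in>cliques I. (- 1) ^ trace_length c * lift t (\<lambda>\<beta>. v \<beta> / of_real (u \<beta>)) \<alpha> c)"
proof -
  let ?g = "\<lambda>c. of_real ((- 1) ^ trace_length c * f \<alpha> c) * (of_real \<rho> * t) ^ trace_length c :: 'b"
  have "(\<Sum>c\<in>cliques_between I act \<alpha> \<beta>. ?g c) * v \<beta>
      = (\<Sum>c\<in>cliques I. if act (Some \<alpha>) c = Some \<beta> then ?g c * v \<beta> else 0)" for \<beta>
    unfolding sum_distrib_right
    by (intro sum.mono_neutral_cong_left)
      (auto simp: cliques_between_def traces_between_def finite_cliques cliques_carrier)
  then have "(\<Sum>\<beta>\<in>UNIV. (\<Sum>c\<in>cliques_between I act \<alpha> \<beta>. ?g c) * v \<beta>)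
      = (\<Sum>c\<in>cliques I. \<Sum>\<beta>\<in>UNIV. if act (Some \<alpha>) c = Some \<beta> then ?g c * v \<beta> else 0)"
    by (simp only: sum.swap[of _ _ UNIV])
  also have "\<dots> = (\<Sum>c\<in>cliques I. of_real (u \<alpha>) *
      ((- 1) ^ trace_length c * lift t (\<lambda>\<beta>. v \<beta> / of_real (u \<beta>)) \<alpha> c))"
  proof (rule sum.cong)
    fix c assume c: "c \<in> cliques I"
    show "(\<Sum>\<beta>\<in>UNIV. if act (Some \<alpha>) c = Some \<beta> then ?g c * v \<beta> else 0)
      = of_real (u \<alpha>) * ((- 1) ^ trace_length c * lift t (\<lambda>\<beta>. v \<beta> / of_real (u \<beta>)) \<alpha> c)"
    proof (cases "act (Some \<alpha>) c")
      case (Some \<beta>)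
      have "weight \<alpha> c = \<rho> ^ trace_length c * (u \<beta> / u \<alpha>) * f \<alpha> c"
        using weight[OF cliques_carrier[OF c]] by (simp add: twisted_def Some \<Delta>)
      then have "f \<alpha> c * \<rho> ^ trace_length c = u \<alpha> * weight \<alpha> c / u \<beta>"
        using u[of \<alpha>] u[of \<beta>] by (simp add: field_simps)
      then have "of_real (f \<alpha> c * \<rho> ^ trace_length c) = (of_real (u \<alpha> * weight \<alpha> c / u \<beta>) :: 'b)"
        by (rule arg_cong)
      then have eq: "of_real (f \<alpha> c) * of_real \<rho> ^ trace_length c
          = (of_real (u \<alpha>) * of_real (weight \<alpha> c) / of_real (u \<beta>) :: 'b)" by simp
      have "?g c * v \<beta> = (- 1) ^ trace_length c *
          (of_real (f \<alpha> c) * of_real \<rho> ^ trace_length c) * t ^ trace_length c * v \<beta>"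
        by (simp add: power_mult_distrib)
      also have "\<dots> = of_real (u \<alpha>) * ((- 1) ^ trace_length c *
          (of_real (weight \<alpha> c) * t ^ trace_length c * (v \<beta> / of_real (u \<beta>))))"
        unfolding eq by simp
      finally show ?thesis by (simp add: Some lift_def)
    qed (simp add: lift_def)
  qed simp
  finally show ?thesis by (simp only: sum_distrib_left)
qed

end

theorem theorem4p19:
  fixes I :: "('a::finite \<times> 'a) set"
    and act :: "'s::finite option \<Rightarrow> 'a trace \<Rightarrow> 's option"
    and f :: "'s \<Rightarrow> 'a trace \<Rightarrow> real"
    and \<rho> :: real
    and \<Delta> :: "'s \<Rightarrow> 's \<Rightarrow> real"
  assumes "irreducible_system I act"
    and "valuation I act f"
    and "\<rho> > 0"
    and "positive_cocycle \<Delta>"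
    and "probabilistic_valuation I act (twisted act \<rho> \<Delta> f)"
  shows "(poly (moebius_det I act f) \<rho> = 0 \<and>
          (\<forall>z::complex. poly (map_poly complex_of_real (moebius_det I act f)) z = 0 \<longrightarrow> \<rho> \<le> cmod z)) \<and>
         dim {v. matrix_eval (moebius_matrix I act f) \<rho> *v v = 0} = 1 \<and>
         (\<exists>U :: real ^ 's.
            (\<forall>\<alpha>. U $ \<alpha> > 0) \<and>
            {v. matrix_eval (moebius_matrix I act f) \<rho> *v v = 0} = span {U} \<and>
            (\<forall>\<alpha> \<beta>. \<Delta> \<alpha> \<beta> = U $ \<beta> / U $ \<alpha>))"
proof -
  obtain m where m: "markov_measure I act m"
    and twisted: "\<And>\<alpha> x. x \<in> carrier (trace_monoid I) \<Longrightarrow>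
      twisted act \<rho> \<Delta> f \<alpha> x = measure (m \<alpha>) (cylinder I x)"
    using assms(5) by (auto simp: probabilistic_valuation_def)
  interpret markov_system I act m
    by unfold_locales (rule assms(1), rule m)
  have weight: "weight \<alpha> x = twisted act \<rho> \<Delta> f \<alpha> x" if "x \<in> carrier M" for \<alpha> x
    using twisted[OF that] by (simp add: weight_def)
  \<comment> \<open>By the cocycle identity every row of \<open>\<Delta>\<close> can serve as \<open>U\<close>.\<close>
  define U :: "real ^ 's" where "U = (\<chi> \<beta>. \<Delta> undefined \<beta>)"
  have U_pos: "0 < U $ \<alpha>" for \<alpha> using assms(4) by (simp add: U_def positive_cocycle_def)
  have \<Delta>: "\<Delta> \<alpha> \<beta> = U $ \<beta> / U $ \<alpha>" for \<alpha> \<beta>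
  proof -
    have "U $ \<beta> = U $ \<alpha> * \<Delta> \<alpha> \<beta>"
      using assms(4) by (simp add: U_def positive_cocycle_def)
    then show ?thesis using U_pos[of \<alpha>] by simp
  qed
  note row = moebius_row[OF weight \<Delta> U_pos]
  let ?A = "matrix_eval (moebius_matrix I act f) \<rho>"
  have kernel_iff: "?A *v v = 0 \<longleftrightarrow> in_kernel 1 (\<lambda>\<beta>. v $ \<beta> / U $ \<beta>)" for v
  proof -
    have "(?A *v v) $ \<alpha> = U $ \<alpha> *
      (\<Sum>c\<in>cliques I. (- 1) ^ trace_length c * lift 1 (\<lambda>\<beta>. v $ \<beta> / U $ \<beta>) \<alpha> c)" for \<alpha>
      using row[of \<alpha> "1::real" "\<lambda>\<beta>. v $ \<beta>"]
      by (simp add: matrix_vector_mult_def matrix_eval_def moebius_matrix_def poly_sum poly_monom)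
    moreover have "U $ \<alpha> \<noteq> 0" for \<alpha> using U_pos[of \<alpha>] by simp
    ultimately show ?thesis by (simp add: vec_eq_iff in_kernel_def)
  qed
  have kernel: "{v. ?A *v v = 0} = span {U}"
  proof (rule equalityI; rule subsetI)
    fix v assume "v \<in> {v. ?A *v v = 0}"
    then have ker: "in_kernel 1 (\<lambda>\<beta>. v $ \<beta> / U $ \<beta>)" by (simp add: kernel_iff)
    have "v = (v $ undefined / U $ undefined) *\<^sub>R U"
    proof (rule vec_eq_iff[THEN iffD2], rule allI)
      fix \<alpha>
      have "v $ \<alpha> / U $ \<alpha> = v $ undefined / U $ undefined" by (rule kernel_constant[OF ker])
      then show "v $ \<alpha> = ((v $ undefined / U $ undefined) *\<^sub>R U) $ \<alpha>"
        using U_pos[of \<alpha>] by (simp add: field_simps)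
    qed
    then show "v \<in> span {U}" by (auto simp: span_singleton)
  next
    fix v assume "v \<in> span {U}"
    then obtain k where "v = k *\<^sub>R U" by (auto simp: span_singleton)
    then have "(\<lambda>\<beta>. v $ \<beta> / U $ \<beta>) = (\<lambda>_. k)" using U_pos by (auto simp: less_imp_neq[symmetric])
    then show "v \<in> {v. ?A *v v = 0}" using in_kernel_const by (simp add: kernel_iff)
  qed
  have U_nz: "U \<noteq> 0" using U_pos by (metis less_irrefl zero_index)
  have dim: "dim {v. ?A *v v = 0} = 1" using U_nz by (simp add: kernel)
  have "U \<in> {v. ?A *v v = 0}" unfolding kernel by (rule span_base) simp
  then have "det ?A = 0" using U_nz by (auto simp: det_zero_kernel)
  then have root: "poly (moebius_det I act f) \<rho> = 0"
    using det_ring_hom[of "\<lambda>p. poly p \<rho>" "moebius_matrix I act f"]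
    by (simp add: moebius_det_def matrix_eval_def)
  have smallest: "\<rho> \<le> cmod z"
    if z: "poly (map_poly complex_of_real (moebius_det I act f)) z = 0" for z
  proof (rule ccontr)
    assume "\<not> \<rho> \<le> cmod z"
    define t where "t = z / of_real \<rho>"
    have z_eq: "of_real \<rho> * t = z" and t: "norm t < 1"
      using assms(3) \<open>\<not> \<rho> \<le> cmod z\<close> by (auto simp: t_def norm_divide)
    let ?C = "\<chi> \<alpha> \<beta>. poly (map_poly complex_of_real (moebius_matrix I act f $ \<alpha> $ \<beta>)) z"
    have "det ?C = 0"
      using det_ring_hom[of "\<lambda>p. poly (map_poly complex_of_real p) z" "moebius_matrix I act f"] z
      by (simp add: moebius_det_def map_poly_of_real_add map_poly_of_real_mult)
    then obtain v where v: "v \<noteq> 0" "?C *v v = 0" by (auto simp: det_zero_kernel)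
    have "(?C *v v) $ \<alpha> = of_real (U $ \<alpha>) *
      (\<Sum>c\<in>cliques I. (- 1) ^ trace_length c * lift t (\<lambda>\<beta>. v $ \<beta> / of_real (U $ \<beta>)) \<alpha> c)" for \<alpha>
      using row[of \<alpha> t "\<lambda>\<beta>. v $ \<beta>"]
      by (simp add: matrix_vector_mult_def moebius_matrix_def map_poly_of_real_sum map_poly_monom
          poly_sum poly_monom z_eq)
    moreover have "U $ \<alpha> \<noteq> 0" for \<alpha> using U_pos[of \<alpha>] by simp
    ultimately have "in_kernel t (\<lambda>\<beta>. v $ \<beta> / of_real (U $ \<beta>))"
      using v(2) by (simp add: vec_eq_iff in_kernel_def)
    then have "v $ \<alpha> / of_real (U $ \<alpha>) = 0" for \<alpha> by (rule kernel_zero[OF t])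
    then have "v = 0" using U_pos by (simp add: vec_eq_iff less_imp_neq[symmetric])
    then show False using v(1) by simp
  qed
  show ?thesis using root smallest dim U_pos kernel \<Delta> by blast
qed

end
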